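(* Let $a\in\mathbb R$, $a\neq0$, and $$W(x)=e^{-x^2}\begin{pmatrix}1+a^2x^4&ax^2\\ ax^2&1\end{pmatrix},\qquad x\in\mathbb R.$$ The algebra $\mathcal D(W)$ is generated by $\{I,D_1,D_2,D_3\}$, where $$D_1=\partial^2I+\partial\begin{pmatrix}-2x&4ax\\ 0&-2x\end{pmatrix}+\begin{pmatrix}0&2a\\ 0&4\end{pmatrix},$$ $$\begin{aligned}D_2={}&\partial^4\begin{pmatrix}-ax^2&a^2x^4-1\\ -1&ax^2\end{pmatrix}+\partial^3\begin{pmatrix}-8ax&8a^2x^3+8x\\ 0&0\end{pmatrix}+\partial^2\begin{pmatrix}-12a-\frac8a&12a^2x^2-8x^2+12\\ 0&\frac8a\end{pmatrix}\\ &+\partial\begin{pmatrix}\frac{16x}{a}&-16x\\ 0&-\frac{16x}{a}\end{pmatrix}+\begin{pmatrix}\frac8a&4+\frac{16}{a^2}\\ \frac{16}{a^2}&-\frac8a\end{pmatrix},\end{aligned}$$ $$D_3=\partial^4\begin{pmatrix}1&-ax^2\\ 0&0\end{pmatrix}+\partial^3\begin{pmatrix}-4x&4ax^3\\ 0&0\end{pmatrix}+\partial^2\begin{pmatrix}-10&10ax^2-\frac4a\\ -\frac4a&4x^2\end{pmatrix}+\partial\begin{pmatrix}0&\frac{16x}{a}\\ 0&0\end{pmatrix}+\begin{pmatrix}0&\frac8a\\ 0&\frac{16}{a^2}\end{pmatrix}.$$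
   Context: For a weight matrix $W$ of size $N$ on an interval $(x_0,x_1)$ put $\langle P,Q\rangle_W=\int_{x_0}^{x_1}P(x)W(x)Q(x)^*\,dx$ for $P,Q\in\operatorname{Mat}_N(\mathbb C[x])$. The monic orthogonal polynomials of $W$ are the unique $P_n\in\operatorname{Mat}_N(\mathbb C[x])$, $n\ge0$, of degree $n$ with leading coefficient $I$ and $\langle P_n,P_m\rangle_W=0$ for $n\ne m$. Differential operators $D=\sum_{i=0}^s\partial^iF_i(x)$, $\partial=d/dx$, act on the right on matrix functions: $P\cdot D=\sum_i P^{(i)}F_i$, and products satisfy $P\cdot(D_1D_2)=(P\cdot D_1)\cdot D_2$. $\operatorname{Mat}_N(\Omega[x])$ is the algebra of such operators with coefficients $F_i\in\operatorname{Mat}_N(\mathbb C[x])$. $$\mathcal D(W)=\{D\in\operatorname{Mat}_N(\Omega[x]): P_n\cdot D=\Lambda_n(D)P_n\text{ for some }\Lambda_n(D)\in\operatorname{Mat}_N(\mathbb C),\ \forall n\ge0\}.$$ "Generated" means generated as an algebra over $\mathbb C$. *)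

theory Defs
  imports "HOL-Analysis.Analysis" "HOL-Computational_Algebra.Polynomial"
begin

section \<open>Matrix polynomials\<close>

text \<open>
  An element of \<open>Mat_N(\<complex>[x])\<close> is a square matrix with polynomial entries, so that
  \<^term>\<open>(**)\<close> is the correct product.
\<close>

type_synonym 'n pmat = "complex poly ^ 'n ^ 'n"

definition pmat_eval :: "'n::finite pmat \<Rightarrow> real \<Rightarrow> complex ^ 'n ^ 'n" where
  "pmat_eval P x = (\<chi> i j. poly (P $ i $ j) (complex_of_real x))"

definition pmat_const :: "complex ^ 'n ^ 'n \<Rightarrow> 'n::finite pmat" where
  "pmat_const A = (\<chi> i j. [:A $ i $ j:])"

definition pmat_coeff :: "'n::finite pmat \<Rightarrow> nat \<Rightarrow> complex ^ 'n ^ 'n" where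
  "pmat_coeff P k = (\<chi> i j. coeff (P $ i $ j) k)"

definition pmat_scale :: "complex \<Rightarrow> 'n::finite pmat \<Rightarrow> 'n pmat" where
  "pmat_scale c P = (\<chi> i j. smult c (P $ i $ j))"

definition pmat_deriv :: "'n::finite pmat \<Rightarrow> 'n pmat" where
  "pmat_deriv P = (\<chi> i j. pderiv (P $ i $ j))"


section \<open>Monic orthogonal polynomials of a weight matrix\<close>

definition conj_transpose :: "complex ^ 'n ^ 'n \<Rightarrow> complex ^ 'n ^ 'n::finite" where
  "conj_transpose A = (\<chi> i j. cnj (A $ j $ i))"

definition weight_inner ::
    "ereal \<Rightarrow> ereal \<Rightarrow> (real \<Rightarrow> complex ^ 'n ^ 'n) \<Rightarrow> 'n::finite pmat \<Rightarrow> 'n pmat \<Rightarrow> complex ^ 'n ^ 'n" where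
  "weight_inner x0 x1 W P Q =
     (LBINT x=x0..x1. pmat_eval P x ** W x ** conj_transpose (pmat_eval Q x))"

definition monic_of_degree :: "nat \<Rightarrow> 'n::finite pmat \<Rightarrow> bool" where
  "monic_of_degree n P \<longleftrightarrow> pmat_coeff P n = mat 1 \<and> (\<forall>k>n. pmat_coeff P k = 0)"

definition is_monic_ops ::
    "ereal \<Rightarrow> ereal \<Rightarrow> (real \<Rightarrow> complex ^ 'n ^ 'n) \<Rightarrow> (nat \<Rightarrow> 'n::finite pmat) \<Rightarrow> bool" where
  "is_monic_ops x0 x1 W P \<longleftrightarrow>
     (\<forall>n. monic_of_degree n (P n)) \<and>
     (\<forall>n m. n \<noteq> m \<longrightarrow> weight_inner x0 x1 W (P n) (P m) = 0)"

definition monic_ops ::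
    "ereal \<Rightarrow> ereal \<Rightarrow> (real \<Rightarrow> complex ^ 'n ^ 'n) \<Rightarrow> nat \<Rightarrow> 'n::finite pmat" where
  "monic_ops x0 x1 W = (THE P. is_monic_ops x0 x1 W P)"


section \<open>Right-acting differential operators with polynomial coefficients\<close>

text \<open>
  The operator \<open>\<Sum>i\<le>s. \<partial>\<^sup>i F\<^sub>i\<close> is represented by its finitely supported coefficient
  sequence \<open>[:F\<^sub>0, \<dots>, F\<^sub>s:]\<close>.  The type constructor \<^type>\<open>poly\<close> is used here only as a
  container: its own multiplication (which would multiply matrices entrywise) is irrelevant,
  and the product of operators is \<open>dop_mult\<close> below.
\<close>

type_synonym 'n diffop = "(complex poly ^ 'n ^ 'n) poly"

definition dop_act :: "'n::finite pmat \<Rightarrow> 'n diffop \<Rightarrow> 'n pmat" where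
  "dop_act P D = (\<Sum>i\<le>degree D. (pmat_deriv ^^ i) P ** coeff D i)"

text \<open>
  By Leibniz' rule, \<open>(\<partial>\<^sup>i F)(\<partial>\<^sup>j G) = \<Sum>k\<le>j. (j choose k) \<partial>\<^bsup>i+k\<^esup> F\<^bsup>(j-k)\<^esup> G\<close>; lemmas
  \<open>dop_act_mult\<close> and \<open>dop_act_inject\<close> show that \<open>dop_mult\<close> is the only product with
  \<open>P \<cdot> (D E) = (P \<cdot> D) \<cdot> E\<close>.
\<close>

definition dop_mult :: "'n::finite diffop \<Rightarrow> 'n diffop \<Rightarrow> 'n diffop" where
  "dop_mult D E = (\<Sum>i\<le>degree D. \<Sum>j\<le>degree E. \<Sum>k\<le>j.
     monom (pmat_scale (of_nat (j choose k)) ((pmat_deriv ^^ (j - k)) (coeff D i)) ** coeff E j)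
       (i + k))"

definition dop_one :: "'n::finite diffop" where
  "dop_one = [:mat 1:]"

definition dop_scale :: "complex \<Rightarrow> 'n::finite diffop \<Rightarrow> 'n diffop" where
  "dop_scale c D = map_poly (pmat_scale c) D"

inductive_set dop_algebra :: "'n::finite diffop set \<Rightarrow> 'n diffop set"
  for S :: "'n diffop set" where
  gen: "D \<in> S \<Longrightarrow> D \<in> dop_algebra S"
| zero: "0 \<in> dop_algebra S"
| add: "D \<in> dop_algebra S \<Longrightarrow> E \<in> dop_algebra S \<Longrightarrow> D + E \<in> dop_algebra S"
| scale: "D \<in> dop_algebra S \<Longrightarrow> dop_scale c D \<in> dop_algebra S"
| mult: "D \<in> dop_algebra S \<Longrightarrow> E \<in> dop_algebra S \<Longrightarrow> dop_mult D E \<in> dop_algebra S"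

definition DW :: "ereal \<Rightarrow> ereal \<Rightarrow> (real \<Rightarrow> complex ^ 'n ^ 'n) \<Rightarrow> 'n::finite diffop set" where
  "DW x0 x1 W =
     {D. \<forall>n. \<exists>\<Lambda>. dop_act (monic_ops x0 x1 W n) D = pmat_const \<Lambda> ** monic_ops x0 x1 W n}"


subsection \<open>The product agrees with composition of the actions\<close>

lemma pmat_deriv_add: "pmat_deriv (A + B) = pmat_deriv A + pmat_deriv B"
  by (simp add: pmat_deriv_def vec_eq_iff pderiv_add)

lemma pmat_deriv_zero: "pmat_deriv 0 = 0"
  by (simp add: pmat_deriv_def vec_eq_iff)

lemma pmat_deriv_pow_add: "(pmat_deriv ^^ k) (A + B) = (pmat_deriv ^^ k) A + (pmat_deriv ^^ k) B"
  by (induction k) (auto simp: pmat_deriv_add)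

lemma pmat_deriv_pow_zero: "(pmat_deriv ^^ k) 0 = 0"
  by (induction k) (auto simp: pmat_deriv_zero)

lemma pmat_deriv_pow_sum: "(pmat_deriv ^^ k) (sum f I) = (\<Sum>i\<in>I. (pmat_deriv ^^ k) (f i))"
  by (induction I rule: infinite_finite_induct) (auto simp: pmat_deriv_pow_add pmat_deriv_pow_zero)

lemma pmat_deriv_mult: "pmat_deriv (A ** B) = pmat_deriv A ** B + A ** pmat_deriv B"
proof -
  have sum_pderiv: "pderiv (sum f I) = (\<Sum>i\<in>I. pderiv (f i))" for f :: "'b \<Rightarrow> complex poly" and I
    by (induction I rule: infinite_finite_induct) (auto simp: pderiv_add)
  show ?thesis
    by (simp add: pmat_deriv_def matrix_matrix_mult_def vec_eq_iff sum_pderiv pderiv_mult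
        sum.distrib[symmetric] add.commute mult.commute)
qed

lemma pmat_scale_simps:
  "pmat_scale (c + d) A = pmat_scale c A + pmat_scale d A"
  "pmat_scale c (A + B) = pmat_scale c A + pmat_scale c B"
  "pmat_scale 1 A = A" "pmat_scale 0 A = 0" "pmat_scale c 0 = 0"
  "pmat_deriv (pmat_scale c A) = pmat_scale c (pmat_deriv A)"
  by (simp_all add: pmat_scale_def vec_eq_iff smult_add_left smult_add_right pmat_deriv_def
      pderiv_smult)

lemma pmat_scale_mult:
  "A ** pmat_scale c B = pmat_scale c (A ** B)" "pmat_scale c A ** B = pmat_scale c (A ** B)"
proof -
  have smult_sum: "smult c (sum f I) = (\<Sum>i\<in>I. smult c (f i))" for f :: "'b \<Rightarrow> complex poly" and I
    by (induction I rule: infinite_finite_induct) (auto simp: smult_add_right)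
  show "A ** pmat_scale c B = pmat_scale c (A ** B)" "pmat_scale c A ** B = pmat_scale c (A ** B)"
    by (simp_all add: pmat_scale_def matrix_matrix_mult_def vec_eq_iff smult_sum)
qed

lemma pmat_mult_zero: "A ** (0::'n::finite pmat) = 0" "(0::'n pmat) ** A = 0"
  by (simp_all add: matrix_matrix_mult_def vec_eq_iff)

lemma pmat_mult_sum:
  fixes B :: "'n::finite pmat"
  shows "sum f I ** B = (\<Sum>i\<in>I. f i ** B)" "B ** sum f I = (\<Sum>i\<in>I. B ** f i)"
  by (induction I rule: infinite_finite_induct)
     (auto simp: matrix_add_ldistrib pmat_mult_zero matrix_matrix_mult_def vec_eq_iff
       algebra_simps sum.distrib)

lemma pmat_deriv_leibniz:
  "(pmat_deriv ^^ j) (A ** B) =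
     (\<Sum>k\<le>j. pmat_scale (of_nat (j choose k)) ((pmat_deriv ^^ k) A ** (pmat_deriv ^^ (j - k)) B))"
proof (induction j)
  case 0
  then show ?case by (simp add: pmat_scale_simps)
next
  case (Suc j)
  let ?t = "\<lambda>k l. (pmat_deriv ^^ k) A ** (pmat_deriv ^^ l) B"
  let ?s = "\<lambda>n. pmat_scale (of_nat n) :: 'a pmat \<Rightarrow> 'a pmat"
  have d: "pmat_deriv (sum f I) = (\<Sum>i\<in>I. pmat_deriv (f i))" for f :: "nat \<Rightarrow> 'a pmat" and I
    using pmat_deriv_pow_sum[of 1] by simp
  have "(pmat_deriv ^^ Suc j) (A ** B) =
      (\<Sum>k\<le>j. ?s (j choose k) (?t (Suc k) (j - k))) +
      (\<Sum>k\<le>j. ?s (j choose k) (?t k (Suc (j - k))))"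
    by (simp add: Suc.IH d pmat_scale_simps pmat_deriv_mult sum.distrib)
  also have "(\<Sum>k\<le>j. ?s (j choose k) (?t k (Suc (j - k)))) =
      (\<Sum>k\<le>Suc j. ?s (j choose k) (?t k (Suc j - k)))"
    by (simp add: pmat_scale_simps Suc_diff_le binomial_eq_0)
  also have "\<dots> = ?t 0 (Suc j) + (\<Sum>k\<le>j. ?s (j choose Suc k) (?t (Suc k) (j - k)))"
    by (subst sum.atMost_Suc_shift) (simp add: pmat_scale_simps binomial_eq_0)
  also have "(\<Sum>k\<le>j. ?s (j choose k) (?t (Suc k) (j - k))) + \<dots> =
      ?t 0 (Suc j) + (\<Sum>k\<le>j. ?s (Suc j choose Suc k) (?t (Suc k) (j - k)))"
    by (simp add: pmat_scale_simps sum.distrib algebra_simps)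
  also have "\<dots> = (\<Sum>k\<le>Suc j. ?s (Suc j choose k) (?t k (Suc j - k)))"
    by (subst sum.atMost_Suc_shift) (simp add: pmat_scale_simps)
  finally show ?case .
qed

lemma dop_act_eq:
  assumes "degree D \<le> m"
  shows "dop_act P D = (\<Sum>i\<le>m. (pmat_deriv ^^ i) P ** coeff D i)"
  unfolding dop_act_def
  by (rule sum.mono_neutral_left) (use assms in \<open>auto simp: coeff_eq_0 pmat_mult_zero\<close>)

lemma dop_act_zero: "dop_act P 0 = 0"
  by (simp add: dop_act_def pmat_mult_zero)

lemma dop_act_add: "dop_act P (D + E) = dop_act P D + dop_act P E"
proof -
  define m where "m = max (degree D) (degree E)"
  have "degree (D + E) \<le> m" "degree D \<le> m" "degree E \<le> m"
    by (auto simp: m_def degree_add_le_max)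
  then show ?thesis
    by (simp add: dop_act_eq[of _ m] matrix_add_ldistrib sum.distrib)
qed

lemma dop_act_sum: "dop_act P (sum f I) = (\<Sum>i\<in>I. dop_act P (f i))"
  by (induction I rule: infinite_finite_induct) (auto simp: dop_act_add dop_act_zero)

lemma dop_act_monom: "dop_act P (monom F k) = (pmat_deriv ^^ k) P ** F"
proof -
  have "dop_act P (monom F k) = (\<Sum>i\<le>k. (pmat_deriv ^^ i) P ** (if k = i then F else 0))"
    using dop_act_eq[OF degree_monom_le] by simp
  also have "\<dots> = (\<Sum>i\<le>k. if k = i then (pmat_deriv ^^ i) P ** F else 0)"
    by (rule sum.cong) (auto simp: pmat_mult_zero)
  finally show ?thesis by simp
qed

lemma dop_act_one: "dop_act P dop_one = P"
  by (simp add: dop_act_def dop_one_def)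

lemma dop_act_scale: "dop_act P (dop_scale c D) = pmat_scale c (dop_act P D)"
proof -
  have s: "pmat_scale c (sum f I) = (\<Sum>i\<in>I. pmat_scale c (f i))" for f :: "nat \<Rightarrow> 'a pmat" and I
    by (induction I rule: infinite_finite_induct) (auto simp: pmat_scale_simps)
  have "degree (dop_scale c D) \<le> degree D"
    by (rule degree_le) (simp add: dop_scale_def coeff_map_poly pmat_scale_simps coeff_eq_0)
  from dop_act_eq[OF this] show ?thesis
    by (simp add: dop_scale_def coeff_map_poly pmat_scale_simps pmat_scale_mult s dop_act_def)
qed

lemma dop_act_mult: "dop_act P (dop_mult D E) = dop_act (dop_act P D) E"
proof -
  have "dop_act (dop_act P D) E =
      (\<Sum>j\<le>degree E. \<Sum>i\<le>degree D. \<Sum>k\<le>j. pmat_scale (of_nat (j choose k))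
         ((pmat_deriv ^^ (k + i)) P ** (pmat_deriv ^^ (j - k)) (coeff D i)) ** coeff E j)"
    unfolding dop_act_def
    by (simp add: pmat_deriv_pow_sum pmat_deriv_leibniz pmat_mult_sum funpow_add)
  also have "\<dots> = dop_act P (dop_mult D E)"
    unfolding dop_mult_def
    by (subst sum.swap)
       (simp add: dop_act_sum dop_act_monom pmat_scale_mult matrix_mul_assoc add.commute)
  finally show ?thesis by simp
qed

lemma dop_act_inject:
  assumes "\<And>P. dop_act P D = dop_act P E"
  shows "D = E"
proof (rule ccontr)
  assume "D \<noteq> E"
  define m where "m = (LEAST i. coeff D i \<noteq> coeff E i)"
  from \<open>D \<noteq> E\<close> have "\<exists>i. coeff D i \<noteq> coeff E i"
    by (auto simp: poly_eq_iff)
  then have ne: "coeff D m \<noteq> coeff E m"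
    unfolding m_def by (rule LeastI_ex)
  have eq: "coeff D i = coeff E i" if "i < m" for i
    using not_less_Least[of i "\<lambda>i. coeff D i \<noteq> coeff E i"] that by (auto simp: m_def)
  define Q :: "complex poly \<Rightarrow> 'a pmat" where "Q = mat"
  have Q_deriv: "(pmat_deriv ^^ i) (Q q) = Q ((pderiv ^^ i) q)" for i q
    by (induction i) (auto simp: Q_def pmat_deriv_def mat_def vec_eq_iff)
  have pd: "(pderiv ^^ i) (monom (1::complex) m) = monom (pochhammer (of_nat m - of_nat i + 1) i) (m - i)" if "i \<le> m" for i
    using that
  proof (induction i)
    case (Suc i)
    then have [simp]: "of_nat (m - i) = (of_nat m - of_nat i :: complex)"
      by (simp add: of_nat_diff)
    have "pochhammer (of_nat m - of_nat (Suc i) + 1) (Suc i) =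
        (of_nat m - of_nat i) * pochhammer (of_nat m - of_nat i + 1 :: complex) i"
      by (simp add: pochhammer_rec)
    with Suc show ?case
      by (simp add: pderiv_monom mult.commute)
  qed auto
  have pd0: "(pderiv ^^ i) (monom (1::complex) m) = 0" if "m < i" for i
  proof -
    have "(pderiv ^^ (k + Suc m)) (monom (1::complex) m) = 0" for k
    proof (induction k)
      case 0
      then show ?case by (simp add: pd pderiv_monom)
    next
      case (Suc k)
      then show ?case by simp
    qed
    from this[of "i - Suc m"] that show ?thesis by simp
  qed
  have act: "dop_act (Q (monom 1 m)) G =
      (\<Sum>i<m. (pmat_deriv ^^ i) (Q (monom 1 m)) ** coeff G i) +
      pmat_scale (pochhammer 1 m) (coeff G m)" for G
  proof -
    let ?f = "\<lambda>i. (pmat_deriv ^^ i) (Q (monom 1 m)) ** coeff G i"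
    have Q0: "Q 0 = 0" by (simp add: Q_def mat_def vec_eq_iff)
    have "dop_act (Q (monom 1 m)) G = sum ?f {..max m (degree G)}"
      by (rule dop_act_eq) simp
    also have "\<dots> = sum ?f {..m}"
      by (rule sum.mono_neutral_right) (auto simp: Q_deriv pd0 Q0 pmat_mult_zero)
    also have "\<dots> = sum ?f {..<m} + ?f m"
      by (simp add: lessThan_Suc_atMost[symmetric])
    also have "Q (monom c 0) = pmat_scale c (mat 1)" for c
      by (simp add: Q_def pmat_scale_def mat_def vec_eq_iff monom_0 one_pCons)
    then have "?f m = pmat_scale (pochhammer 1 m) (coeff G m)"
      by (simp add: Q_deriv pd pmat_scale_mult)
    finally show ?thesis .
  qed
  have "pmat_scale (pochhammer 1 m) (coeff D m) = pmat_scale (pochhammer 1 m) (coeff E m)"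
    using assms[of "Q (monom 1 m)"] by (simp add: act eq)
  then have "coeff D m = coeff E m"
    by (simp add: pmat_scale_def vec_eq_iff pochhammer_fact[symmetric] poly_eq_iff)
  with ne show False by simp
qed


section \<open>The weight and the operators of the example\<close>

definition W_ex :: "real \<Rightarrow> real \<Rightarrow> complex ^ 2 ^ 2" where
  "W_ex a x = exp (- (x ^ 2)) *\<^sub>R
     vector [vector [complex_of_real (1 + a ^ 2 * x ^ 4), complex_of_real (a * x ^ 2)],
             vector [complex_of_real (a * x ^ 2), 1]]"

abbreviation pX :: "complex poly" where
  "pX \<equiv> [:0, 1:]"

abbreviation pC :: "real \<Rightarrow> complex poly" where
  "pC r \<equiv> [:complex_of_real r:]"

definition pmat22 :: "complex poly \<Rightarrow> complex poly \<Rightarrow> complex poly \<Rightarrow> complex poly \<Rightarrow> 2 pmat" where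
  "pmat22 p q r s = vector [vector [p, q], vector [r, s]]"

text \<open>Coefficients are listed in increasing order of \<open>\<partial>\<close>.\<close>

definition D1 :: "real \<Rightarrow> 2 diffop" where
  "D1 a =
    [: pmat22 0 (pC (2 * a))
              0 4,
       pmat22 (- 2 * pX) (pC (4 * a) * pX)
              0         (- 2 * pX),
       mat 1 :]"

definition D2 :: "real \<Rightarrow> 2 diffop" where
  "D2 a =
    [: pmat22 (pC (8 / a))        (pC (4 + 16 / a ^ 2))
              (pC (16 / a ^ 2))   (pC (- (8 / a))),
       pmat22 (pC (16 / a) * pX)   (- 16 * pX)
              0                  (pC (- (16 / a)) * pX),
       pmat22 (pC (- 12 * a - 8 / a))  (pC (12 * a ^ 2) * pX ^ 2 - 8 * pX ^ 2 + 12)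
              0                       (pC (8 / a)),
       pmat22 (pC (- 8 * a) * pX)  (pC (8 * a ^ 2) * pX ^ 3 + 8 * pX)
              0                  0,
       pmat22 (pC (- a) * pX ^ 2)  (pC (a ^ 2) * pX ^ 4 - 1)
              (- 1)              (pC a * pX ^ 2) :]"

definition D3 :: "real \<Rightarrow> 2 diffop" where
  "D3 a =
    [: pmat22 0  (pC (8 / a))
              0  (pC (16 / a ^ 2)),
       pmat22 0  (pC (16 / a) * pX)
              0  0,
       pmat22 (- 10)           (pC (10 * a) * pX ^ 2 - pC (4 / a))
              (pC (- (4 / a)))  (4 * pX ^ 2),
       pmat22 (- 4 * pX)  (pC (4 * a) * pX ^ 3)
              0          0,
       pmat22 1  (pC (- a) * pX ^ 2)
              0  0 :]"

end

theory Submission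
  imports Defs "HOL-Probability.Distributions"
begin

text \<open>
  Since \<open>W = e\<^bsup>-x\<^sup>2\<^esup> T T\<^sup>*\<close> with \<open>T\<close> polynomial and unipotent, right multiplication by \<open>T\<close> carries
  the orthogonal polynomials of \<open>W\<close> to combinations of Hermite polynomials: up to a constant left
  factor, \<open>P\<^sub>n T\<close> has the rows \<open>(H\<^sub>n, a H\<^bsub>n+2\<^esub>)\<close> and \<open>(- a n (n - 1) H\<^bsub>n-2\<^esub> / 4, H\<^sub>n)\<close>.
  A differential operator with polynomial coefficients maps \<open>H\<^sub>n\<close> to a combination of the
  \<open>H\<^bsub>n+k\<^esub>\<close> whose coefficients are polynomials in \<open>n\<close>.  Comparing these coefficients, with
  \<open>\<rho>(n) = 1 + a\<^sup>2 (n + 1) (n + 2) / 4\<close>, the eigenvalues of an operator in \<open>D(W)\<close> on these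
  sequences are exactly the matrices with rows \<open>(s(n) + (\<rho>(n) - 1) e(n), \<rho>(n) b(n))\<close> and
  \<open>(\<rho>(n-2) c(n), s(n-2) - e(n-2))\<close> for polynomials \<open>s, e, b, c\<close>.  An operator is determined by
  its eigenvalues, and all of these are generated by the eigenvalues of the \<open>D\<^sub>i\<close>:
  \<open>diag(-2n, 4-2n)\<close> for \<open>D\<^sub>1\<close>, \<open>16/a\<^sup>2\<close> times the matrix with rows \<open>(0, \<rho>(n))\<close>,
  \<open>(\<rho>(n-2), 0)\<close> for \<open>D\<^sub>2\<close>, and \<open>16/a\<^sup>2 diag(0, \<rho>(n-2))\<close> for \<open>D\<^sub>3\<close>.
\<close>

section \<open>Hermite polynomials and the Gaussian functional\<close>

text \<open>Monic normalisation: 2^n times \<open>hermite n\<close> is the usual Hermite polynomial.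
  The recursion applies the raising operator, which sends p to -(1/2) e^(x^2) (e^(-x^2) p)'.\<close>

primrec hermite :: "nat \<Rightarrow> complex poly" where
  "hermite 0 = 1"
| "hermite (Suc n) = pX * hermite n - smult (1/2) (pderiv (hermite n))"

text \<open>Differentiating the recursion leaves x H' - H''/2, and the induction hypothesis turns
  this into a multiple of the recursion one index lower.\<close>

lemma pderiv_hermite_Suc: "pderiv (hermite (Suc n)) = smult (of_nat (Suc n)) (hermite n)"
proof (induction n)
  case 0
  then show ?case by (simp add: pderiv_pCons)
next
  case (Suc n)
  have "pderiv (hermite (Suc (Suc n))) =
      hermite (Suc n) + pX * pderiv (hermite (Suc n)) - smult (1/2) (pderiv (pderiv (hermite (Suc n))))"
    by (subst hermite.simps(2)) (simp add: pderiv_diff pderiv_mult pderiv_smult pderiv_pCons)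
  also have "\<dots> = hermite (Suc n) + smult (of_nat (Suc n)) (hermite (Suc n))"
  proof -
    have "smult (of_nat (Suc n)) (hermite (Suc n)) = pX * smult (of_nat (Suc n)) (hermite n) -
        smult (1/2) (pderiv (smult (of_nat (Suc n)) (hermite n)))"
      by (simp add: smult_diff_right pderiv_smult mult.commute)
    then show ?thesis
      by (simp only: Suc.IH add_diff_eq[symmetric])
  qed
  finally show ?case by (simp only: of_nat_Suc smult_add_left smult_1_left)
qed

lemma pderiv_hermite: "pderiv (hermite n) = smult (of_nat n) (hermite (n - 1))"
  by (cases n) (simp_all add: pderiv_hermite_Suc del: hermite.simps(2))

text \<open>Compute the derivative of \<open>hermite (Suc n)\<close> twice, by the lowering rule and
  from the recursion.\<close>

lemma hermite_ode:
  "pderiv (pderiv (hermite n)) = 2 * pX * pderiv (hermite n) - of_nat (2 * n) * hermite n"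
proof -
  have "smult (of_nat (Suc n)) (hermite n) =
      hermite n + pX * pderiv (hermite n) - smult (1/2) (pderiv (pderiv (hermite n)))"
    unfolding pderiv_hermite_Suc[symmetric]
    by (simp add: pderiv_diff pderiv_mult pderiv_smult pderiv_pCons)
  then have "smult (1/2) (pderiv (pderiv (hermite n))) = pX * pderiv (hermite n) - smult (of_nat n) (hermite n)"
    by (simp add: smult_add_left algebra_simps)
  from arg_cong[OF this, of "smult 2"] show ?thesis
    by (simp add: smult_diff_right of_nat_poly numeral_poly)
qed

lemma coeff_hermite_above: "n < k \<Longrightarrow> coeff (hermite n) k = 0"
proof (induction n arbitrary: k)
  case (Suc n)
  then show ?case
    by (cases k) (auto simp: coeff_pCons coeff_pderiv split: nat.splits)
qed simp

lemma coeff_hermite_self: "coeff (hermite n) n = 1"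
  by (induction n) (auto simp: coeff_pCons coeff_pderiv coeff_hermite_above)

lemma cnj_hermite: "map_poly cnj (hermite n) = hermite n"
proof (induction n)
  case (Suc n)
  have "coeff (map_poly cnj (hermite n)) k = coeff (hermite n) k" for k
    by (simp add: Suc.IH)
  then have "cnj (coeff (hermite n) k) = coeff (hermite n) k" for k
    by (simp add: coeff_map_poly)
  then show ?case
    by (intro poly_eqI) (simp add: coeff_map_poly coeff_pCons coeff_pderiv split: nat.splits)
qed (simp add: map_poly_1)

section \<open>The Gaussian integral of polynomials and Hermite orthogonality\<close>

definition gauss :: "complex poly \<Rightarrow> complex" where
  "gauss p = (LINT x|lborel. exp (- x\<^sup>2) *\<^sub>R poly p (of_real x))"

text \<open>For k = 2j the value is Gamma(j + 1/2), the integral of x^(2j) e^(-x^2).\<close>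

definition gauss_moment :: "nat \<Rightarrow> real" where
  "gauss_moment k = (if even k then sqrt pi * fact k / (4 ^ (k div 2) * fact (k div 2)) else 0)"

lemma gauss_moment_Suc_Suc: "2 * gauss_moment (Suc (Suc k)) = real (Suc k) * gauss_moment k"
proof (cases "even k")
  case True
  then obtain j where j: "k = 2 * j" by blast
  then have "Suc (Suc k) div 2 = Suc j" "k div 2 = j" by auto
  with j show ?thesis
    by (simp add: gauss_moment_def divide_simps)
qed (simp add: gauss_moment_def)

lemma has_bochner_integral_gauss_moment:
  "has_bochner_integral lborel (\<lambda>x::real. exp (- x\<^sup>2) * x ^ k) (gauss_moment k)"
proof -
  \<comment> \<open>Standard deviation 1 / sqrt 2 turns the normal density into e^(-x^2) / sqrt pi,
    so the normal moments give the required ones.\<close>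
  have nd: "normal_density 0 (1 / sqrt 2) x = exp (- x\<^sup>2) / sqrt pi" for x
    by (simp add: normal_density_def power_divide)
  obtain j where "k = 2 * j \<or> k = 2 * j + 1"
    by (metis oddE evenE)
  then show ?thesis
  proof
    assume k: "k = 2 * j"
    have "has_bochner_integral lborel (\<lambda>x. sqrt pi * (normal_density 0 (1 / sqrt 2) x * (x - 0) ^ k))
        (sqrt pi * (fact k / ((2 / (1 / sqrt 2)\<^sup>2) ^ j * fact j)))"
      unfolding k by (intro has_bochner_integral_mult_right normal_moment_even) auto
    then show ?thesis
      by (simp add: nd k gauss_moment_def power_divide)
  next
    assume k: "k = 2 * j + 1"
    have "has_bochner_integral lborel (\<lambda>x. sqrt pi * (normal_density 0 (1 / sqrt 2) x * (x - 0) ^ k)) (sqrt pi * 0)"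
      unfolding k by (intro has_bochner_integral_mult_right normal_moment_odd) auto
    then show ?thesis
      by (simp add: nd k gauss_moment_def)
  qed
qed

lemma has_bochner_integral_gauss:
  "has_bochner_integral lborel (\<lambda>x. exp (- x\<^sup>2) *\<^sub>R poly p (of_real x)) (gauss p)"
proof -
  have "has_bochner_integral lborel
      (\<lambda>x. \<Sum>k\<le>degree p. of_real (exp (- x\<^sup>2) * x ^ k) * coeff p k)
      (\<Sum>k\<le>degree p. of_real (gauss_moment k) * coeff p k)"
    by (intro has_bochner_integral_sum has_bochner_integral_mult_left
        has_bochner_integral_of_real has_bochner_integral_gauss_moment)
  moreover have "(\<Sum>k\<le>degree p. of_real (exp (- x\<^sup>2) * x ^ k) * coeff p k) =
      exp (- x\<^sup>2) *\<^sub>R poly p (of_real x)" for x :: real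
    unfolding poly_altdef by (simp add: scaleR_conv_of_real sum_distrib_left mult_ac)
  ultimately show ?thesis
    unfolding gauss_def by (simp add: has_bochner_integral_iff)
qed

lemma gauss_add: "gauss (p + q) = gauss p + gauss q"
  using has_bochner_integral_add[OF has_bochner_integral_gauss has_bochner_integral_gauss, of p q]
  by (intro has_bochner_integral_eq[OF has_bochner_integral_gauss])
     (simp add: scaleR_add_right)

lemma gauss_smult: "gauss (smult c p) = c * gauss p"
  using has_bochner_integral_mult_right[OF has_bochner_integral_gauss, of c p]
  by (intro has_bochner_integral_eq[OF has_bochner_integral_gauss]) simp

lemma gauss_zero [simp]: "gauss 0 = 0"
  using gauss_smult[of 0 0] by simp

lemma gauss_minus: "gauss (- p) = - gauss p"
  using gauss_smult[of "-1" p] by simp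

lemma gauss_diff: "gauss (p - q) = gauss p - gauss q"
  using gauss_add[of p "- q"] by (simp add: gauss_minus)

lemma gauss_sum: "gauss (sum f I) = (\<Sum>i\<in>I. gauss (f i))"
  by (induction I rule: infinite_finite_induct) (auto simp: gauss_add)

lemma gauss_monom: "gauss (monom 1 k) = of_real (gauss_moment k)"
proof -
  have "has_bochner_integral lborel (\<lambda>x. complex_of_real (exp (- x\<^sup>2) * x ^ k)) (of_real (gauss_moment k))"
    by (intro has_bochner_integral_of_real has_bochner_integral_gauss_moment)
  then show ?thesis
    by (intro has_bochner_integral_eq[OF has_bochner_integral_gauss])
       (simp add: poly_monom scaleR_conv_of_real)
qed

lemma gauss_one: "gauss 1 = of_real (sqrt pi)"
  using gauss_monom[of 0] by (simp add: gauss_moment_def)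

text \<open>Integration by parts against e^(-x^2), checked on monomials through the moment
  recurrence, so that no boundary terms arise.\<close>

lemma gauss_pderiv: "gauss (pderiv p) = 2 * gauss (pX * p)"
proof -
  have m: "gauss (pderiv (monom 1 k)) = 2 * gauss (pX * monom 1 k)" for k
  proof -
    have "pX * monom 1 k = (monom 1 (Suc k) :: complex poly)"
      by (simp add: monom_Suc)
    moreover have "pderiv (monom 1 k) = smult (of_nat k) (monom (1::complex) (k - 1))"
      by (simp add: pderiv_monom smult_monom)
    moreover have "2 * gauss_moment (Suc k) = real k * gauss_moment (k - 1)"
      using gauss_moment_Suc_Suc[of "k - 1"] by (cases k) (auto simp: gauss_moment_def)
    then have "complex_of_real (2 * gauss_moment (Suc k)) = of_real (real k * gauss_moment (k - 1))"
      by simp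
    ultimately show ?thesis
      by (simp add: gauss_smult gauss_monom)
  qed
  have p: "p = (\<Sum>k\<le>degree p. smult (coeff p k) (monom 1 k))"
    by (simp add: smult_monom poly_as_sum_of_monoms)
  have pd: "pderiv (sum f I) = (\<Sum>i\<in>I. pderiv (f i))" for f :: "nat \<Rightarrow> complex poly" and I
    by (induction I rule: infinite_finite_induct) (auto simp: pderiv_add)
  have "pX * (\<Sum>k\<le>degree p. smult (coeff p k) (monom 1 k)) = (\<Sum>k\<le>degree p. smult (coeff p k) (pX * monom 1 k))"
    unfolding sum_distrib_left by (simp only: mult_smult_right)
  then show ?thesis
    by (subst (1 2) p)
       (simp only: pd gauss_sum pderiv_smult gauss_smult m sum_distrib_left mult.left_commute)
qed

text \<open>The Gaussian adjoint of d/dx is 2x - d/dx, which is twice the raising operator.\<close>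

lemma gauss_pderiv_hermite: "gauss (pderiv p * hermite m) = 2 * gauss (p * hermite (Suc m))"
proof -
  have "gauss (pderiv p * hermite m) = gauss (pderiv (p * hermite m)) - gauss (p * pderiv (hermite m))"
    by (simp add: pderiv_mult gauss_diff[symmetric] mult.commute)
  also have "\<dots> = 2 * gauss (p * hermite (Suc m))"
    by (simp add: gauss_pderiv gauss_smult gauss_diff algebra_simps)
  finally show ?thesis .
qed

text \<open>The squared norm of \<open>hermite n\<close> for the weight e^(-x^2).\<close>

definition hnorm :: "nat \<Rightarrow> real" where
  "hnorm n = sqrt pi * fact n / 2 ^ n"

lemma hnorm_pos: "hnorm n > 0"
  by (simp add: hnorm_def)

lemma hnorm_Suc: "2 * hnorm (Suc n) = real (Suc n) * hnorm n"
  by (simp add: hnorm_def)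

text \<open>Each induction step trades one raising of the right factor for a derivative of the left
  one, which lowers n. The base case pairs with 1, whose derivative is 0.\<close>

lemma gauss_hermite_hermite:
  "gauss (hermite n * hermite m) = (if n = m then of_real (hnorm m) else 0)"
proof (induction m arbitrary: n)
  case 0
  have "gauss (hermite (Suc k) * hermite 0) = 0" for k
    using gauss_pderiv_hermite[of 1 k] by simp
  then show ?case
    by (cases n) (auto simp: gauss_one hnorm_def simp del: hermite.simps(2))
next
  case (Suc m)
  have "2 * gauss (hermite n * hermite (Suc m)) = of_nat n * gauss (hermite (n - 1) * hermite m)"
    by (simp only: gauss_pderiv_hermite[symmetric] pderiv_hermite) (simp add: gauss_smult)
  also have "\<dots> = (if n = Suc m then of_real (real (Suc m) * hnorm m) else 0)"
    by (cases n) (auto simp: Suc.IH)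
  also have "\<dots> = 2 * (if n = Suc m then of_real (hnorm (Suc m)) else 0)"
    unfolding hnorm_Suc[symmetric] by (simp del: of_nat_Suc)
  finally show ?case by simp
qed

text \<open>Coefficients in the Hermite basis, with the convention that the basis vectors of negative
  index vanish.\<close>

definition hcoef :: "int \<Rightarrow> complex poly \<Rightarrow> complex" where
  "hcoef k p = (if k < 0 then 0 else gauss (p * hermite (nat k)) / of_real (hnorm (nat k)))"

lemma hcoef_neg: "k < 0 \<Longrightarrow> hcoef k p = 0"
  by (simp add: hcoef_def)

lemma hcoef_add: "hcoef k (p + q) = hcoef k p + hcoef k q"
  by (simp add: hcoef_def distrib_right gauss_add add_divide_distrib)

lemma hcoef_smult: "hcoef k (smult c p) = c * hcoef k p"
  by (simp add: hcoef_def gauss_smult)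

lemma hcoef_zero [simp]: "hcoef k 0 = 0"
  by (simp add: hcoef_def)

lemma hcoef_hermite: "hcoef k (hermite n) = (if k = int n then 1 else 0)"
  using hnorm_pos[of n] by (auto simp: hcoef_def gauss_hermite_hermite)

text \<open>Dual to H_(k+1)' = (k + 1) H_k. It holds for every integer k: at k = -1 the factor k + 1
  vanishes, and below that both coefficients do.\<close>

lemma hcoef_pderiv: "hcoef k (pderiv p) = of_int (k + 1) * hcoef (k + 1) p"
proof (cases "k < 0")
  case True
  then show ?thesis by (cases "k = -1") (auto simp: hcoef_def)
next
  case False
  define m where "m = nat k"
  have k: "k = int m" "nat (int m + 1) = Suc m" using False by (auto simp: m_def)
  have h: "of_real (hnorm (Suc m)) = (of_nat (Suc m) / 2 * of_real (hnorm m) :: complex)"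
    by (simp add: hnorm_def)
  have ks: "of_int (k + 1) = (of_nat (Suc m) :: complex)" by (simp add: k)
  have "hnorm m \<noteq> 0" "of_nat (Suc m) \<noteq> (0 :: complex)" using hnorm_pos[of m] by (simp_all del: of_nat_Suc)
  then show ?thesis
    unfolding ks by (simp add: hcoef_def k gauss_pderiv_hermite h del: hermite.simps of_nat_Suc)
qed

text \<open>Dual to the three-term recurrence x H_m = H_(m+1) + (m/2) H_(m-1). The zero convention
  for negative indices covers k = 0 and k = -1.\<close>

lemma hcoef_pX: "hcoef k (pX * p) = hcoef (k - 1) p + of_int (k + 1) / 2 * hcoef (k + 1) p"
proof (cases "k < 0")
  case True
  then show ?thesis by (cases "k = -1") (auto simp: hcoef_def)
next
  case False
  define m where "m = nat k"
  have k: "k = int m" "nat (int m + 1) = Suc m" using False by (auto simp: m_def)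
  have h: "of_real (hnorm (Suc m)) = (of_nat (Suc m) / 2 * of_real (hnorm m) :: complex)" for m
    by (simp add: hnorm_def)
  have nz: "hnorm m \<noteq> 0" for m using hnorm_pos[of m] by simp
  have "(pX * p) * hermite m = p * (pX * hermite m)"
    by (simp only: mult.assoc mult.left_commute)
  also have "pX * hermite m = hermite (Suc m) + smult (of_nat m / 2) (hermite (m - 1))"
    by (simp add: pderiv_hermite)
  finally have "gauss ((pX * p) * hermite m) =
      gauss (p * hermite (Suc m)) + of_nat m / 2 * gauss (p * hermite (m - 1))"
    by (simp add: distrib_left gauss_add gauss_smult del: hermite.simps)
  then have e: "hcoef k (pX * p) =
      gauss (p * hermite (Suc m)) / of_real (hnorm m) +
      of_nat m / 2 * gauss (p * hermite (m - 1)) / of_real (hnorm m)"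
    by (simp add: hcoef_def k add_divide_distrib del: hermite.simps mult_pCons_left)
  have "gauss (p * hermite (Suc m)) / of_real (hnorm m) = of_int (k + 1) / 2 * hcoef (k + 1) p"
  proof -
    have ks: "of_int (k + 1) = (of_nat (Suc m) :: complex)" by (simp add: k)
    have "of_nat (Suc m) \<noteq> (0 :: complex)" by (simp del: of_nat_Suc)
    then show ?thesis
      unfolding ks using nz[of m] by (simp add: hcoef_def k h del: hermite.simps of_nat_Suc)
  qed
  moreover have "of_nat m / 2 * gauss (p * hermite (m - 1)) / of_real (hnorm m) = hcoef (k - 1) p"
  proof (cases m)
    case 0
    then show ?thesis by (simp add: k hcoef_def)
  next
    case (Suc j)
    then have kj: "k - 1 = int j" using k by simp
    show ?thesis
      unfolding Suc kj h using nz[of j] by (simp add: hcoef_def h del: hermite.simps of_nat_Suc)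
  qed
  ultimately show ?thesis
    unfolding e by simp
qed

section \<open>Sequences with polynomial Hermite coefficients\<close>

text \<open>The polynomial may depend on the shift k but not on n. For negative k the zero
  convention forces roots at small n, which the eigenvalue computation exploits.\<close>

definition hermite_regular :: "(nat \<Rightarrow> complex poly) \<Rightarrow> bool" where
  "hermite_regular \<psi> \<longleftrightarrow>
     (\<forall>k::int. \<exists>f. \<forall>n. hcoef (int n + k) (\<psi> n) = poly f (of_nat n))"

lemma hermite_regularD:
  assumes "hermite_regular \<psi>"
  obtains f where "\<And>n. hcoef (int n + k) (\<psi> n) = poly f (of_nat n)"
  using assms unfolding hermite_regular_def by metis

lemma hermite_regular_hermite: "hermite_regular hermite"
  unfolding hermite_regular_def
proof
  fix k :: int
  show "\<exists>f. \<forall>n. hcoef (int n + k) (hermite n) = poly f (of_nat n)"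
    by (rule exI[of _ "if k = 0 then 1 else 0"]) (simp add: hcoef_hermite)
qed

lemma hermite_regular_add:
  assumes "hermite_regular \<phi>" "hermite_regular \<psi>"
  shows "hermite_regular (\<lambda>n. \<phi> n + \<psi> n)"
  unfolding hermite_regular_def
proof
  fix k :: int
  obtain f where f: "\<And>n. hcoef (int n + k) (\<phi> n) = poly f (of_nat n)"
    using hermite_regularD[OF assms(1)] by blast
  obtain g where g: "\<And>n. hcoef (int n + k) (\<psi> n) = poly g (of_nat n)"
    using hermite_regularD[OF assms(2)] by blast
  show "\<exists>f. \<forall>n. hcoef (int n + k) (\<phi> n + \<psi> n) = poly f (of_nat n)"
    by (rule exI[of _ "f + g"]) (simp add: hcoef_add f g)
qed

lemma hermite_regular_smult:
  assumes "hermite_regular \<psi>"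
  shows "hermite_regular (\<lambda>n. smult c (\<psi> n))"
  unfolding hermite_regular_def
proof
  fix k :: int
  obtain f where f: "\<And>n. hcoef (int n + k) (\<psi> n) = poly f (of_nat n)"
    using hermite_regularD[OF assms] by blast
  show "\<exists>f. \<forall>n. hcoef (int n + k) (smult c (\<psi> n)) = poly f (of_nat n)"
    by (rule exI[of _ "smult c f"]) (simp add: hcoef_smult f)
qed

lemma hermite_regular_zero: "hermite_regular (\<lambda>n. 0)"
  using hermite_regular_smult[OF hermite_regular_hermite, of 0] by simp

lemma hermite_regular_pderiv:
  assumes "hermite_regular \<psi>"
  shows "hermite_regular (\<lambda>n. pderiv (\<psi> n))"
  unfolding hermite_regular_def
proof
  fix k :: int
  obtain f where f: "\<And>n. hcoef (int n + (k + 1)) (\<psi> n) = poly f (of_nat n)"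
    using hermite_regularD[OF assms] by blast
  show "\<exists>f. \<forall>n. hcoef (int n + k) (pderiv (\<psi> n)) = poly f (of_nat n)"
    by (rule exI[of _ "[:of_int (k + 1), 1:] * f"])
       (use f in \<open>simp add: hcoef_pderiv add.assoc algebra_simps\<close>)
qed

lemma hermite_regular_pX:
  assumes "hermite_regular \<psi>"
  shows "hermite_regular (\<lambda>n. pX * \<psi> n)"
  unfolding hermite_regular_def
proof
  fix k :: int
  obtain f where f: "\<And>n. hcoef (int n + (k + 1)) (\<psi> n) = poly f (of_nat n)"
    using hermite_regularD[OF assms] by blast
  obtain g where g: "\<And>n. hcoef (int n + (k - 1)) (\<psi> n) = poly g (of_nat n)"
    using hermite_regularD[OF assms] by blast
  have f': "hcoef (int n + k + 1) (\<psi> n) = poly f (of_nat n)"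
    and g': "hcoef (int n + k - 1) (\<psi> n) = poly g (of_nat n)" for n
    using f[of n] g[of n] by (simp_all add: algebra_simps)
  show "\<exists>f. \<forall>n. hcoef (int n + k) (pX * \<psi> n) = poly f (of_nat n)"
    by (rule exI[of _ "g + smult (1/2) ([:of_int (k + 1), 1:] * f)"])
       (simp only: hcoef_pX f' g', simp add: algebra_simps)
qed

lemma hermite_regular_mult:
  assumes "hermite_regular \<psi>"
  shows "hermite_regular (\<lambda>n. q * \<psi> n)"
proof (induction q)
  case 0
  then show ?case by (simp add: hermite_regular_zero)
next
  case (pCons c q)
  from hermite_regular_add[OF hermite_regular_smult[OF assms, of c] hermite_regular_pX[OF pCons.IH]]
  show ?case by simp
qed

lemma hermite_regular_sum:
  assumes "\<And>i. i \<in> I \<Longrightarrow> hermite_regular (\<psi> i)"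
  shows "hermite_regular (\<lambda>n. \<Sum>i\<in>I. \<psi> i n)"
  using assms
  by (induction I rule: infinite_finite_induct) (auto simp: hermite_regular_zero hermite_regular_add)

lemma hermite_regular_matrix_mult:
  assumes "\<And>i j. hermite_regular (\<lambda>n. X n $ i $ j)"
  shows "hermite_regular (\<lambda>n. (X n ** B) $ i $ j)"
  unfolding matrix_matrix_mult_def
  by (auto simp: mult.commute[of _ "B $ _ $ _"] intro!: hermite_regular_sum hermite_regular_mult assms)

lemma hermite_regular_pmat_deriv_pow:
  assumes "\<And>i j. hermite_regular (\<lambda>n. X n $ i $ j)"
  shows "hermite_regular (\<lambda>n. (pmat_deriv ^^ m) (X n) $ i $ j)"
proof (induction m arbitrary: i j)
  case (Suc m)
  then show ?case by (simp add: pmat_deriv_def hermite_regular_pderiv)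
qed (simp add: assms)

text \<open>A fixed operator is built from derivatives, multiplications by polynomials and sums, and
  each of these preserves regularity.\<close>

lemma hermite_regular_dop_act:
  assumes "\<And>i j. hermite_regular (\<lambda>n. X n $ i $ j)"
  shows "hermite_regular (\<lambda>n. dop_act (X n) D $ i $ j)"
  unfolding dop_act_def sum_component
  by (intro hermite_regular_sum hermite_regular_matrix_mult hermite_regular_pmat_deriv_pow assms)

lemma hermite_regular_mat:
  "hermite_regular (\<lambda>n. (mat (hermite n) :: 'n::finite pmat) $ i $ j)"
  by (cases "i = j") (simp_all add: mat_def hermite_regular_hermite hermite_regular_zero)

lemma pmat_deriv_const_mult: "(pmat_deriv ^^ k) (pmat_const M ** P) = pmat_const M ** (pmat_deriv ^^ k) P"
proof (induction k)
  case (Suc k)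
  have "pmat_deriv (pmat_const M) = 0"
    by (simp add: pmat_deriv_def pmat_const_def vec_eq_iff pderiv_pCons)
  then show ?case by (simp add: Suc.IH pmat_deriv_mult pmat_mult_zero)
qed simp

text \<open>Operators act from the right, so constant matrices on the left pass through
  them.\<close>

lemma dop_act_const_mult: "dop_act (pmat_const M ** P) D = pmat_const M ** dop_act P D"
  by (simp add: dop_act_def pmat_deriv_const_mult matrix_mul_assoc pmat_mult_sum)

lemma pmat_add_mult: "(A + B) ** C = A ** C + B ** (C :: 'n::finite pmat)"
  by (simp add: matrix_matrix_mult_def vec_eq_iff distrib_right sum.distrib)

lemma dop_act_left_add: "dop_act (P + Q) D = dop_act P D + dop_act Q D"
  by (simp add: dop_act_def pmat_deriv_pow_add pmat_add_mult sum.distrib)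

section \<open>An orthogonal sequence adapted to the weight\<close>

text \<open>Polymorphic in the entries, so that constant and polynomial matrices share one set of
  computation rules.\<close>

definition mat22 :: "'a \<Rightarrow> 'a \<Rightarrow> 'a \<Rightarrow> 'a \<Rightarrow> 'a ^ 2 ^ 2" where
  "mat22 p q r s = (\<chi> i j. if i = 1 then if j = 1 then p else q else if j = 1 then r else s)"

lemma mat22_nth [simp]:
  "mat22 p q r s $ 1 $ 1 = p" "mat22 p q r s $ 1 $ 2 = q"
  "mat22 p q r s $ 2 $ 1 = r" "mat22 p q r s $ 2 $ 2 = s"
  by (simp_all add: mat22_def)

lemma mat22_eta: "A = mat22 (A $ 1 $ 1) (A $ 1 $ 2) (A $ 2 $ 1) (A $ 2 $ 2)"
  by (simp add: vec_eq_iff forall_2)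

lemma mat22_eq_iff:
  "mat22 p q r s = mat22 p' q' r' s' \<longleftrightarrow> p = p' \<and> q = q' \<and> r = r' \<and> s = s'"
  by (auto simp: vec_eq_iff forall_2)

lemma mat22_mult:
  "mat22 p q r s ** mat22 p' q' r' s' =
     mat22 (p * p' + q * r') (p * q' + q * s') (r * p' + s * r') (r * q' + s * s')"
  by (simp add: matrix_matrix_mult_def vec_eq_iff forall_2 sum_2)

lemma mat22_add: "mat22 p q r s + mat22 p' q' r' s' = mat22 (p + p') (q + q') (r + r') (s + s')"
  by (simp add: vec_eq_iff forall_2)

lemma mat22_zero: "0 = mat22 0 0 0 0"
  by (simp add: vec_eq_iff forall_2)

lemma mat22_mat: "mat c = mat22 c 0 0 c"
  by (simp add: vec_eq_iff forall_2 mat_def)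

lemma pmat22_eq: "pmat22 p q r s = mat22 p q r s"
  by (simp add: pmat22_def vec_eq_iff forall_2)

lemma pmat_const_mat22: "pmat_const (mat22 p q r s) = mat22 [:p:] [:q:] [:r:] [:s:]"
  by (simp add: pmat_const_def vec_eq_iff forall_2)

lemma pmat_deriv_mat22: "pmat_deriv (mat22 p q r s) = mat22 (pderiv p) (pderiv q) (pderiv r) (pderiv s)"
  by (simp add: pmat_deriv_def vec_eq_iff forall_2)

lemma pmat_scale_mat22: "pmat_scale c (mat22 p q r s) = mat22 (smult c p) (smult c q) (smult c r) (smult c s)"
  by (simp add: pmat_scale_def vec_eq_iff forall_2)

text \<open>\<open>W(x) = e\<^bsup>-x\<^sup>2\<^esup> T(x) T(x)\<^sup>*\<close>.\<close>

definition Tmat :: "real \<Rightarrow> 2 pmat" where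
  "Tmat a = mat22 1 [:0, 0, of_real a:] 0 1"

definition Tinv :: "real \<Rightarrow> 2 pmat" where
  "Tinv a = mat22 1 [:0, 0, - of_real a:] 0 1"

lemma Tmat_Tinv: "Tmat a ** Tinv a = mat 1"
  by (simp add: Tinv_def Tmat_def mat22_mult mat22_mat mat22_eq_iff)

definition U :: "real \<Rightarrow> nat \<Rightarrow> 2 pmat" where
  "U a n = mat22 (hermite n) (smult (of_real a) (hermite (n + 2)))
     (smult (- of_real a / 4) (pderiv (pderiv (hermite n)))) (hermite n)"

text \<open>This is \<open>U a n ** Tinv a\<close> with the terms of degree n + 2 in entry (1,2)
  already cancelled by the Hermite equation, so that degree n is visible.\<close>

definition Q :: "real \<Rightarrow> nat \<Rightarrow> 2 pmat" where
  "Q a n = mat22 (hermite n)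
     (smult (- of_real a / 2) (pX * pderiv (hermite n) + smult (of_nat n + 1) (hermite n)))
     (smult (- of_real a / 4) (pderiv (pderiv (hermite n))))
     (hermite n + smult (of_real (a\<^sup>2) / 4) (pX ^ 2 * pderiv (pderiv (hermite n))))"

lemma Q_Tmat: "Q a n ** Tmat a = U a n"
proof -
  have 1: "hermite (n + 2) = pX * (pX * hermite n) - smult (1/2) (pX * pderiv (hermite n)) -
      smult (1/2) (hermite n + pX * pderiv (hermite n) - smult (1/2) (pderiv (pderiv (hermite n))))"
    by (simp add: numeral_2_eq_2 pderiv_diff pderiv_smult pderiv_pCons)
  show ?thesis
    unfolding Q_def U_def Tmat_def mat22_mult mat22_eq_iff
    by (intro conjI; rule poly_ext; (simp only: 1 hermite_ode)?)
       (simp_all add: field_simps power2_eq_square)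
qed

section \<open>Action of the three generators on the sequence \<open>Q\<close>\<close>

lemma dop_act_pCons: "dop_act P (pCons F G) = P ** F + dop_act (pmat_deriv P) G"
proof -
  have "dop_act P (pCons F G) = (\<Sum>i\<le>Suc (degree G). (pmat_deriv ^^ i) P ** coeff (pCons F G) i)"
    by (rule dop_act_eq) (simp add: degree_pCons_le)
  also have "\<dots> = P ** F + (\<Sum>i\<le>degree G. (pmat_deriv ^^ i) (pmat_deriv P) ** coeff G i)"
    by (subst sum.atMost_Suc_shift) (simp add: funpow_swap1)
  finally show ?thesis by (simp add: dop_act_def)
qed

text \<open>By the Hermite equation every derivative of H_n is a polynomial combination of H_n and
  H_n'. Carrying the pair of coefficients with n symbolic reduces the eigenvalue identities to
  identities between explicit polynomials.\<close>

definition ode_comb :: "nat \<Rightarrow> complex poly \<Rightarrow> complex poly \<Rightarrow> complex poly" where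
  "ode_comb n p q = p * hermite n + q * pderiv (hermite n)"

lemma pderiv_ode_comb:
  "pderiv (ode_comb n p q) =
     ode_comb n (pderiv p - smult (2 * of_nat n) q) (p + pderiv q + pCons 0 (smult 2 q))"
  unfolding ode_comb_def
  by (rule poly_ext)
     (simp add: pderiv_add pderiv_mult hermite_ode algebra_simps)

lemma ode_comb_mult: "ode_comb n p q * r = ode_comb n (p * r) (q * r)"
  by (simp add: ode_comb_def algebra_simps)

lemma mult_ode_comb: "[:c:] * ode_comb n p q = ode_comb n (smult c p) (smult c q)"
  by (simp add: ode_comb_def smult_add_right)

lemma ode_comb_add: "ode_comb n p q + ode_comb n p' q' = ode_comb n (p + p') (q + q')"
  by (simp add: ode_comb_def algebra_simps)

lemma ode_comb_diff: "ode_comb n p q - ode_comb n p' q' = ode_comb n (p - p') (q - q')"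
  by (simp add: ode_comb_def algebra_simps)

lemma ode_comb_minus: "- ode_comb n p q = ode_comb n (- p) (- q)"
  by (simp add: ode_comb_def)

lemma ode_comb_eqI:
  "p = p' \<Longrightarrow> q = q' \<Longrightarrow> ode_comb n p q = ode_comb n p' q'"
  "p = 0 \<Longrightarrow> q = 0 \<Longrightarrow> ode_comb n p q = 0"
  by (simp_all add: ode_comb_def)

lemma Q_ode_comb:
  "Q a n = mat22 (ode_comb n 1 0) (ode_comb n [:- of_real a * (of_nat n + 1) / 2:] [:0, - of_real a / 2:])
     (ode_comb n [:of_real a * of_nat n / 2:] [:0, - of_real a / 2:])
     (ode_comb n [:1, 0, - of_real (a\<^sup>2) * of_nat n / 2:] [:0, 0, 0, of_real (a\<^sup>2) / 2:])"
  unfolding Q_def ode_comb_def mat22_eq_iff hermite_ode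
  by (intro conjI; rule poly_ext; simp add: one_pCons field_simps power2_eq_square)

text \<open>The squared norms of the two rows of \<open>U a n\<close> are \<open>hnorm n\<close>
  times \<open>rho a n\<close> and \<open>rho a (n - 2)\<close>. The argument is complex, so n - 2
  is not truncated.\<close>

definition rho :: "real \<Rightarrow> complex \<Rightarrow> complex" where
  "rho a z = 1 + of_real (a\<^sup>2) * (z + 1) * (z + 2) / 4"

text \<open>Conjugated by T, the operator becomes \<partial>^2 - 2x \<partial> + diag(0, 4), which
  acts diagonally on Hermite polynomials. The check, as for the other generators, collects each
  entry into one \<open>ode_comb\<close> and compares coefficient pairs.\<close>

lemma dop_act_Q_D1:
  "dop_act (Q a n) (D1 a) = pmat_const (mat22 (- 2 * of_nat n) 0 0 (4 - 2 * of_nat n)) ** Q a n"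
  unfolding D1_def pmat22_eq Q_ode_comb
  apply (simp add: dop_act_pCons dop_act_zero pmat_deriv_mat22 mat22_mult mat22_add pmat_const_mat22
     pderiv_ode_comb pderiv_pCons mat22_mat numeral_poly power2_eq_square power3_eq_cube power4_eq_xxxx del: mult_pCons_left mult_pCons_right)
  apply (simp only: ode_comb_mult mult_ode_comb ode_comb_add ode_comb_diff ode_comb_minus mat22_eq_iff)
  apply (intro conjI; rule ode_comb_eqI; simp add: one_pCons field_simps power2_eq_square)
  done

lemma dop_act_Q_D3:
  assumes "a \<noteq> 0"
  shows "dop_act (Q a n) (D3 a) =
    pmat_const (mat22 0 0 0 (of_real (16 / a\<^sup>2) * rho a (of_nat n - 2))) ** Q a n"
  using assms
  unfolding D3_def rho_def pmat22_eq Q_ode_comb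
  apply (simp add: dop_act_pCons dop_act_zero pmat_deriv_mat22 mat22_mult mat22_add pmat_const_mat22
     pderiv_ode_comb pderiv_pCons mat22_mat numeral_poly power2_eq_square power3_eq_cube power4_eq_xxxx del: mult_pCons_left mult_pCons_right)
  apply (simp only: ode_comb_mult mult_ode_comb ode_comb_add ode_comb_diff ode_comb_minus mat22_eq_iff)
  apply (intro conjI; rule ode_comb_eqI; simp add: one_pCons field_simps power2_eq_square)
  done

lemma dop_act_Q_D2:
  assumes "a \<noteq> 0"
  shows "dop_act (Q a n) (D2 a) = pmat_const (mat22 0 (of_real (16 / a\<^sup>2) * rho a (of_nat n))
    (of_real (16 / a\<^sup>2) * rho a (of_nat n - 2)) 0) ** Q a n"
  using assms
  unfolding D2_def rho_def pmat22_eq Q_ode_comb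
  apply (simp add: dop_act_pCons dop_act_zero pmat_deriv_mat22 mat22_mult mat22_add pmat_const_mat22
     pderiv_ode_comb pderiv_pCons mat22_mat numeral_poly power2_eq_square power3_eq_cube power4_eq_xxxx del: mult_pCons_left mult_pCons_right)
  apply (simp only: ode_comb_mult mult_ode_comb ode_comb_add ode_comb_diff ode_comb_minus mat22_eq_iff)
  apply (intro conjI; rule ode_comb_eqI; simp add: one_pCons field_simps power2_eq_square)
  done

section \<open>The shape of the eigenvalues\<close>

lemma rho_nonzero: "rho a (of_nat n) \<noteq> 0"
proof -
  have "rho a (of_nat n) = of_real (1 + a\<^sup>2 * (real n + 1) * (real n + 2) / 4)"
    by (simp add: rho_def)
  moreover have "1 + a\<^sup>2 * (real n + 1) * (real n + 2) / 4 > 0"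
    by (intro add_pos_nonneg) auto
  ultimately show ?thesis
    by (metis of_real_eq_0_iff less_irrefl)
qed

lemma poly_eqI_of_nat:
  fixes p q :: "complex poly"
  assumes "\<And>n. poly p (of_nat n) = poly q (of_nat n)"
  shows "p = q"
proof (rule ccontr)
  assume "p \<noteq> q"
  then have "finite {z. poly (p - q) z = 0}"
    by (intro poly_roots_finite) simp
  moreover have "range of_nat \<subseteq> {z. poly (p - q) z = 0}"
    using assms by auto
  moreover have "infinite (range (of_nat :: nat \<Rightarrow> complex))"
    by (intro range_inj_infinite inj_of_nat)
  ultimately show False
    using finite_subset by blast
qed

text \<open>Since z - 2 is a complex difference, the entries for n = 0 and n = 1 are values of the
  polynomials at -2 and -1.\<close>

definition eigen_family ::
    "real \<Rightarrow> complex poly \<Rightarrow> complex poly \<Rightarrow> complex poly \<Rightarrow> complex poly \<Rightarrow> nat \<Rightarrow> complex ^ 2 ^ 2" where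
  "eigen_family a s e b c n = (let z = of_nat n in
     mat22 (poly s z + (rho a z - 1) * poly e z) (rho a z * poly b z)
       (rho a (z - 2) * poly c z) (poly s (z - 2) - poly e (z - 2)))"

lemma pderiv_pderiv_hermite:
  "pderiv (pderiv (hermite n)) = smult (of_nat (n * (n - 1))) (hermite (n - 2))"
  by (simp add: pderiv_hermite pderiv_smult numeral_2_eq_2)

text \<open>Constants on the left pass through operators, so the action on \<open>Q\<close> is
  determined by the action on the single sequence H_m T^(-1). Truncation in n - 2 is harmless
  because n (n - 1) vanishes there.\<close>

lemma Q_decompose:
  "Q a n = mat (hermite n) ** Tinv a
     + pmat_const (mat22 0 (of_real a) 0 0) ** (mat (hermite (n + 2)) ** Tinv a)
     + pmat_const (mat22 0 0 (- of_real a * of_nat (n * (n - 1)) / 4) 0) ** (mat (hermite (n - 2)) ** Tinv a)"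
proof -
  have "Q a n = U a n ** Tinv a"
    by (simp flip: Q_Tmat matrix_mul_assoc add: Tmat_Tinv)
  moreover have "U a n = mat (hermite n)
     + pmat_const (mat22 0 (of_real a) 0 0) ** mat (hermite (n + 2))
     + pmat_const (mat22 0 0 (- of_real a * of_nat (n * (n - 1)) / 4) 0) ** mat (hermite (n - 2))"
    unfolding U_def pderiv_pderiv_hermite
    by (simp add: mat22_mat pmat_const_mat22 mat22_mult mat22_add mat22_eq_iff del: hermite.simps)
  ultimately show ?thesis
    by (simp add: pmat_add_mult matrix_mul_assoc)
qed

text \<open>The eigenvalue equation becomes four scalar relations between regular sequences.
  Comparing Hermite coefficients in them expresses the entries of L by polynomials in n.\<close>

lemma eigenvalue_form:
  assumes "a \<noteq> 0" and eig: "\<And>n. dop_act (Q a n) D = pmat_const (L n) ** Q a n"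
  obtains s e b c where "L = eigen_family a s e b c"
proof -
  note [simp del] = add_2_eq_Suc add_2_eq_Suc'
  let ?a = "complex_of_real a"
  \<comment> \<open>The image of H_n times the identity under T^(-1) D T; its entries are
    regular.\<close>
  define Y where "Y n = dop_act (mat (hermite n) ** Tinv a) D ** Tmat a" for n
  define A B C E where "A n = Y n $ 1 $ 1" and "B n = Y n $ 1 $ 2"
    and "C n = Y n $ 2 $ 1" and "E n = Y n $ 2 $ 2" for n
  define \<alpha> \<beta> \<gamma> \<delta> where "\<alpha> n = L n $ 1 $ 1" and "\<beta> n = L n $ 1 $ 2"
    and "\<gamma> n = L n $ 2 $ 1" and "\<delta> n = L n $ 2 $ 2" for n
  \<comment> \<open>Chosen so that the second row of \<open>U a n\<close> is (-v n H_(n-2),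
    H_n).\<close>
  define v where "v n = ?a * of_nat (n * (n - 1)) / 4" for n
  have Y_eta: "Y n = mat22 (A n) (B n) (C n) (E n)" for n
    unfolding A_def B_def C_def E_def by (rule mat22_eta)
  have L_eta: "L n = mat22 (\<alpha> n) (\<beta> n) (\<gamma> n) (\<delta> n)" for n
    unfolding \<alpha>_def \<beta>_def \<gamma>_def \<delta>_def by (rule mat22_eta)
  have "hermite_regular (\<lambda>n. Y n $ i $ j)" for i j
    unfolding Y_def
    by (intro hermite_regular_matrix_mult hermite_regular_dop_act hermite_regular_mat)
  then have reg: "hermite_regular A" "hermite_regular B" "hermite_regular C" "hermite_regular E"
    unfolding A_def B_def C_def E_def by auto
  have "Y n + pmat_const (mat22 0 ?a 0 0) ** Y (n + 2) + pmat_const (mat22 0 0 (- v n) 0) ** Y (n - 2) =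
      pmat_const (L n) ** U a n" for n
  proof -
    have "dop_act (Q a n) D ** Tmat a = pmat_const (L n) ** U a n"
      by (simp add: eig Q_Tmat flip: matrix_mul_assoc)
    moreover have "- v n = - ?a * of_nat (n * (n - 1)) / 4"
      by (simp add: v_def)
    ultimately show ?thesis
      unfolding Q_decompose
      by (simp only: Y_def dop_act_left_add dop_act_const_mult pmat_add_mult matrix_mul_assoc[symmetric])
  qed
  then have rows:
    "A n + smult ?a (C (n + 2)) = smult (\<alpha> n) (hermite n) + smult (- \<beta> n * v n) (hermite (n - 2))"
    "B n + smult ?a (E (n + 2)) = smult (\<alpha> n * ?a) (hermite (n + 2)) + smult (\<beta> n) (hermite n)"
    "C n + smult (- v n) (A (n - 2)) = smult (\<gamma> n) (hermite n) + smult (- \<delta> n * v n) (hermite (n - 2))"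
    "E n + smult (- v n) (B (n - 2)) = smult (\<gamma> n * ?a) (hermite (n + 2)) + smult (\<delta> n) (hermite n)"
    for n
    unfolding Y_eta L_eta U_def pderiv_pderiv_hermite
    by (auto simp: mat22_mat pmat_const_mat22 mat22_mult mat22_add mat22_eq_iff v_def mult_ac
        simp del: hermite.simps)
  have coefs:
    "hcoef k (A n) + ?a * hcoef k (C (n + 2)) =
       \<alpha> n * (if k = int n then 1 else 0) - \<beta> n * v n * (if k = int (n - 2) then 1 else 0)"
    "hcoef k (B n) + ?a * hcoef k (E (n + 2)) =
       \<alpha> n * ?a * (if k = int (n + 2) then 1 else 0) + \<beta> n * (if k = int n then 1 else 0)"
    "hcoef k (C n) - v n * hcoef k (A (n - 2)) =
       \<gamma> n * (if k = int n then 1 else 0) - \<delta> n * v n * (if k = int (n - 2) then 1 else 0)"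
    "hcoef k (E n) - v n * hcoef k (B (n - 2)) =
       \<gamma> n * ?a * (if k = int (n + 2) then 1 else 0) + \<delta> n * (if k = int n then 1 else 0)"
    for k n
    using rows[of n, THEN arg_cong[of _ _ "hcoef k"]]
    by (simp_all only: hcoef_add hcoef_smult hcoef_hermite) simp_all
  have v2: "v (n + 2) = ?a * (of_nat n + 1) * (of_nat n + 2) / 4" for n
    by (simp add: v_def algebra_simps)
  have rho_v: "rho a (of_nat n) = 1 + ?a * v (n + 2)" for n
    unfolding v2 rho_def by (simp add: power2_eq_square)
  have v_small: "v n = 0" if "n < 2" for n
    using that by (auto simp: v_def less_2_cases_iff)
  \<comment> \<open>With truncated subtraction n - 2 = n happens only at n = 0, where v
    vanishes.\<close>
  have v_self: "v n * (if int n = int (n - 2) then 1 else 0) = 0" for n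
    by (cases "n = 0") (auto simp: v_def)
  obtain s where s: "\<And>n. hcoef (int n + 0) (A n) = poly s (of_nat n)"
    using hermite_regularD[OF reg(1)] by blast
  obtain b where b: "\<And>n. hcoef (int n + 0) (B n) = poly b (of_nat n)"
    using hermite_regularD[OF reg(2)] by blast
  obtain c where c: "\<And>n. hcoef (int n + 0) (C n) = poly c (of_nat n)"
    using hermite_regularD[OF reg(3)] by blast
  obtain f where f: "\<And>n. hcoef (int n + (-2)) (C n) = poly f (of_nat n)"
    using hermite_regularD[OF reg(3)] by blast
  obtain d where d: "\<And>n. hcoef (int n + 0) (E n) = poly d (of_nat n)"
    using hermite_regularD[OF reg(4)] by blast

  \<comment> \<open>Eliminate the coefficient of H_n in \<open>E (n + 2)\<close> between the second
    relation at n and the fourth at n + 2.\<close>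
  have \<beta>: "\<beta> n = rho a (of_nat n) * poly b (of_nat n)" for n
  proof -
    have "hcoef (int n) (E (n + 2)) = v (n + 2) * poly b (of_nat n)"
      using coefs(4)[of "int n" "n + 2"] b[of n] by simp
    then show ?thesis
      using coefs(2)[of "int n" n] b[of n] by (simp add: rho_v algebra_simps)
  qed
  \<comment> \<open>Eliminate the coefficient of H_n in \<open>A (n - 2)\<close> between the third
    relation at n and the first at n - 2; for n < 2 the factor v n removes it.\<close>
  have \<gamma>: "\<gamma> n = rho a (of_nat n - 2) * poly c (of_nat n)" for n
  proof (cases "n < 2")
    case True
    then have "rho a (of_nat n - 2) = 1"
      by (auto simp: rho_def less_2_cases_iff)
    moreover have "\<gamma> n = poly c (of_nat n)"
      using coefs(3)[of "int n" n] c[of n] v_small[OF True] by simp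
    ultimately show ?thesis by simp
  next
    case False
    then obtain m where m: "n = m + 2" by (metis le_add_diff_inverse2 not_less)
    have "\<gamma> n = poly c (of_nat n) - v n * hcoef (int n) (A m)"
      using coefs(3)[of "int n" n] c[of n] m by simp
    moreover have "hcoef (int n) (A m) = - ?a * poly c (of_nat n)"
    proof -
      have "int n \<noteq> int m" "int n \<noteq> int (m - 2)" using m by arith+
      then show ?thesis
        using coefs(1)[of "int n" m] c[of n] unfolding m[symmetric] by (simp add: add_eq_0_iff)
    qed
    moreover have "rho a (of_nat n - 2) = 1 + ?a * v n"
      using rho_v[of m] m by simp
    ultimately show ?thesis by (simp add: algebra_simps)
  qed

  \<comment> \<open>The Hermite coefficients of negative index vanish, so \<open>f\<close> has the roots \<open>0\<close> and \<open>1\<close>.\<close>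
  have "poly f 0 = 0" "poly f 1 = 0"
    using f[of 0] f[of 1] by (simp_all add: hcoef_neg)
  then obtain g where g: "f = [:0, 1:] * ([:-1, 1:] * g)"
  proof -
    assume *: thesis if "f = [:0, 1:] * ([:-1, 1:] * g)" for g
    from \<open>poly f 0 = 0\<close> obtain h where h: "f = [:0, 1:] * h"
      using poly_eq_0_iff_dvd[of f 0] by (auto elim: dvdE)
    with \<open>poly f 1 = 0\<close> have "poly h 1 = 0" by simp
    then obtain g where "h = [:-1, 1:] * g"
      using poly_eq_0_iff_dvd[of h 1] by (auto elim: dvdE)
    with h show thesis by (intro *) simp
  qed
  \<comment> \<open>As f(n) = n (n - 1) g(n), the shift by 2 and the factor 4/a give f(n + 2) = v(n
    + 2) e(n) with e a polynomial.\<close>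
  define e where "e = smult (4 / ?a) (g \<circ>\<^sub>p [:2, 1:])"

  have fe: "poly f (of_nat (n + 2)) = v (n + 2) * poly e (of_nat n)" for n
    unfolding v2 using \<open>a \<noteq> 0\<close> by (simp add: g e_def poly_pcompose field_simps)
  have C2: "hcoef (int n) (C (n + 2)) = v (n + 2) * poly e (of_nat n)" for n
  proof -
    have "int (n + 2) + - 2 = int n" by simp
    with f[of "n + 2"] show ?thesis by (simp only: fe)
  qed
  have \<alpha>: "\<alpha> n = poly s (of_nat n) + (rho a (of_nat n) - 1) * poly e (of_nat n)" for n
    using coefs(1)[of "int n" n] s[of n] v_self[of n] by (auto simp: C2 rho_v algebra_simps)
  \<comment> \<open>The third relation at n + 2 has the common factor v(n + 2), which is nonzero and
    can be cancelled.\<close>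
  have \<delta>2: "\<delta> (n + 2) = poly s (of_nat n) - poly e (of_nat n)" for n
  proof -
    have "v (n + 2) \<noteq> 0"
    proof -
      obtain k where "k = (n + 2) * (n + 2 - 1)" "k > 0" by simp
      then have "v (n + 2) = ?a * of_nat k / 4" by (simp only: v_def)
      then show ?thesis using \<open>a \<noteq> 0\<close> \<open>k > 0\<close> by auto
    qed
    moreover have "v (n + 2) * poly e (of_nat n) - v (n + 2) * poly s (of_nat n) = - \<delta> (n + 2) * v (n + 2)"
      using coefs(3)[of "int n" "n + 2"] s[of n] by (simp add: C2)
    then have "v (n + 2) * (poly e (of_nat n) - poly s (of_nat n)) = v (n + 2) * (- \<delta> (n + 2))"
      by (simp add: algebra_simps)
    ultimately have "poly e (of_nat n) - poly s (of_nat n) = - \<delta> (n + 2)"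
      using mult_left_cancel by blast
    then show ?thesis by (simp add: algebra_simps)
  qed
  define r where "r = [:1 + ?a\<^sup>2 / 2, 3 * ?a\<^sup>2 / 4, ?a\<^sup>2 / 4:]"
  have r: "poly r z = rho a z" for z
    by (simp add: r_def rho_def field_simps)
  \<comment> \<open>For n < 2 no such division by v is possible, but there \<delta> n = d(n).
    Eliminating the coefficient of H_(n+2) in \<open>B n\<close> determines d at all n + 2, hence as
    a polynomial, and so also at 0 and 1.\<close>
  have "poly (d \<circ>\<^sub>p [:2, 1:]) (of_nat n) = poly (s + (r - [:2:]) * e) (of_nat n)" for n
  proof -
    let ?d = "poly d (of_nat (n + 2))" and ?x = "hcoef (int (n + 2)) (B n)"
    have 1: "?x + ?a * ?d = \<alpha> n * ?a"
      using coefs(2)[of "int (n + 2)" n] d[of "n + 2"] by simp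
    have 2: "?d - v (n + 2) * ?x = \<delta> (n + 2)"
      using coefs(4)[of "int (n + 2)" "n + 2"] d[of "n + 2"] by simp
    have "rho a (of_nat n) * ?d = \<delta> (n + 2) + v (n + 2) * (\<alpha> n * ?a)"
      unfolding 1[symmetric] 2[symmetric] rho_v by (simp add: algebra_simps)
    also have "\<dots> = rho a (of_nat n) * (poly s (of_nat n) + (rho a (of_nat n) - 2) * poly e (of_nat n))"
      unfolding \<alpha> \<delta>2 rho_v by (simp add: algebra_simps)
    finally have "?d = poly s (of_nat n) + (rho a (of_nat n) - 2) * poly e (of_nat n)"
      using rho_nonzero mult_left_cancel by blast
    then show ?thesis by (simp add: poly_pcompose r add.commute)
  qed
  then have "d \<circ>\<^sub>p [:2, 1:] = s + (r - [:2:]) * e"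
    by (rule poly_eqI_of_nat)
  then have "poly (d \<circ>\<^sub>p [:2, 1:]) (of_nat n - 2) = poly (s + (r - [:2:]) * e) (of_nat n - 2)" for n
    by simp
  then have d_shift: "poly d (of_nat n) =
      poly s (of_nat n - 2) + (rho a (of_nat n - 2) - 2) * poly e (of_nat n - 2)" for n
    by (simp add: poly_pcompose r)
  have \<delta>: "\<delta> n = poly s (of_nat n - 2) - poly e (of_nat n - 2)" for n
  proof (cases "n < 2")
    case True
    then have "rho a (of_nat n - 2) = 1"
      by (auto simp: rho_def less_2_cases_iff)
    moreover have "\<delta> n = poly d (of_nat n)"
      using coefs(4)[of "int n" n] d[of n] v_small[OF True] by simp
    ultimately show ?thesis by (simp add: d_shift)
  next
    case False
    then obtain m where "n = m + 2" by (metis le_add_diff_inverse2 not_less)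
    then show ?thesis using \<delta>2[of m] by simp
  qed
  have "L = eigen_family a s e b c"
    by (rule ext) (simp add: eigen_family_def Let_def L_eta \<alpha> \<beta> \<gamma> \<delta>)
  then show thesis by (rule that)
qed

section \<open>Generating the algebra of eigenvalue sequences\<close>

text \<open>Eigenvalue sequences realised by elements of the generated algebra; the remaining task
  is to show that every \<open>eigen_family\<close> is among them.\<close>

definition symbols :: "real \<Rightarrow> (nat \<Rightarrow> complex ^ 2 ^ 2) set" where
  "symbols a = {L. \<exists>G\<in>dop_algebra {dop_one, D1 a, D2 a, D3 a}.
     \<forall>n. dop_act (Q a n) G = pmat_const (L n) ** Q a n}"

lemma symbolsI:
  assumes "G \<in> dop_algebra {dop_one, D1 a, D2 a, D3 a}"
    and "\<And>n. dop_act (Q a n) G = pmat_const (L n) ** Q a n"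
  shows "L \<in> symbols a"
  using assms unfolding symbols_def by blast

lemma pmat_const_add: "pmat_const (A + B) = pmat_const A + pmat_const B"
  by (simp add: pmat_const_def vec_eq_iff)

lemma pmat_const_one: "pmat_const (mat 1) = mat 1"
  by (simp add: pmat_const_def mat_def vec_eq_iff one_pCons)

lemma pmat_const_mult: "pmat_const (A ** B) = pmat_const A ** pmat_const (B :: complex ^ 'n::finite ^ 'n)"
proof -
  have "(\<Sum>k\<in>I. [:f k:]) = [:sum f I:]" for f :: "'n \<Rightarrow> complex" and I
    by (induction I rule: infinite_finite_induct) auto
  then show ?thesis
    by (simp add: pmat_const_def vec_eq_iff matrix_matrix_mult_def mult.commute)
qed

lemma symbols_add:
  assumes "L \<in> symbols a" "M \<in> symbols a"
  shows "(\<lambda>n. L n + M n) \<in> symbols a"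
  using assms unfolding symbols_def
  by (auto simp: dop_act_add pmat_const_add pmat_add_mult intro!: bexI[OF _ dop_algebra.add])

text \<open>The order of factors is preserved: applying H to L Q gives L (Q H) = L M Q, because left
  constants pass through H.\<close>

lemma symbols_mult:
  assumes "L \<in> symbols a" "M \<in> symbols a"
  shows "(\<lambda>n. L n ** M n) \<in> symbols a"
proof -
  obtain G H where G: "G \<in> dop_algebra {dop_one, D1 a, D2 a, D3 a}"
      "\<And>n. dop_act (Q a n) G = pmat_const (L n) ** Q a n"
    and H: "H \<in> dop_algebra {dop_one, D1 a, D2 a, D3 a}"
      "\<And>n. dop_act (Q a n) H = pmat_const (M n) ** Q a n"
    using assms unfolding symbols_def by auto
  show ?thesis
    by (rule symbolsI[OF dop_algebra.mult[OF G(1) H(1)]])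
       (simp add: dop_act_mult dop_act_const_mult pmat_const_mult G(2) H(2)
         flip: matrix_mul_assoc)
qed

lemma symbols_scale:
  assumes "(\<lambda>n. mat22 (p n) (q n) (r n) (s n)) \<in> symbols a"
  shows "(\<lambda>n. mat22 (k * p n) (k * q n) (k * r n) (k * s n)) \<in> symbols a"
proof -
  obtain G where G: "G \<in> dop_algebra {dop_one, D1 a, D2 a, D3 a}"
    "\<And>n. dop_act (Q a n) G = pmat_const (mat22 (p n) (q n) (r n) (s n)) ** Q a n"
    using assms unfolding symbols_def by auto
  show ?thesis
    by (rule symbolsI[OF dop_algebra.scale[OF G(1), of k]])
       (simp add: dop_act_scale G(2) pmat_scale_mult(2)[symmetric] pmat_const_mat22 pmat_scale_mat22)
qed

lemma symbols_one: "(\<lambda>n. mat22 1 0 0 1) \<in> symbols a"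
  by (rule symbolsI[of dop_one])
     (auto intro: dop_algebra.gen simp: dop_act_one pmat_const_one mat22_mat[symmetric])

text \<open>A rescaling of \<open>D1\<close> provides a number operator, whose second entry carries
  the shift by 2.\<close>

lemma symbols_number: "(\<lambda>n. mat22 (of_nat n) 0 0 (of_nat n - 2)) \<in> symbols a"
proof -
  have "(\<lambda>n. mat22 (- 2 * of_nat n) 0 0 (4 - 2 * of_nat n)) \<in> symbols a"
    by (rule symbolsI[OF dop_algebra.gen, of "D1 a"]) (auto simp: dop_act_Q_D1)
  from symbols_scale[OF this, of "- 1/2"] show ?thesis
    by (simp add: algebra_simps)
qed

lemma symbols_poly: "(\<lambda>n. mat22 (poly f (of_nat n)) 0 0 (poly f (of_nat n - 2))) \<in> symbols a"
proof (induction f)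
  case 0
  from symbols_scale[OF symbols_one, of 0] show ?case by simp
next
  case (pCons k f)
  from symbols_add[OF symbols_scale[OF symbols_one, of k] symbols_mult[OF symbols_number pCons.IH]]
  show ?case by (simp add: mat22_mult mat22_add)
qed

lemma symbols_D3:
  assumes "a \<noteq> 0"
  shows "(\<lambda>n. mat22 0 0 0 (rho a (of_nat n - 2))) \<in> symbols a"
proof -
  have "(\<lambda>n. mat22 0 0 0 (of_real (16 / a\<^sup>2) * rho a (of_nat n - 2))) \<in> symbols a"
    by (rule symbolsI[OF dop_algebra.gen, of "D3 a"]) (use assms in \<open>auto simp: dop_act_Q_D3\<close>)
  from symbols_scale[OF this, of "of_real (a\<^sup>2 / 16)"] show ?thesis
    using assms by simp
qed

lemma symbols_D2:
  assumes "a \<noteq> 0"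
  shows "(\<lambda>n. mat22 0 (rho a (of_nat n)) (rho a (of_nat n - 2)) 0) \<in> symbols a"
proof -
  have "(\<lambda>n. mat22 0 (of_real (16 / a\<^sup>2) * rho a (of_nat n))
      (of_real (16 / a\<^sup>2) * rho a (of_nat n - 2)) 0) \<in> symbols a"
    by (rule symbolsI[OF dop_algebra.gen, of "D2 a"]) (use assms in \<open>auto simp: dop_act_Q_D2\<close>)
  from symbols_scale[OF this, of "of_real (a\<^sup>2 / 16)"] show ?thesis
    using assms by simp
qed

text \<open>The commutator with the number operator has the opposite sign on the two off-diagonal
  entries and so separates them.\<close>

lemma symbols_off_diagonal:
  assumes "a \<noteq> 0"
  shows "(\<lambda>n. mat22 0 (rho a (of_nat n)) 0 0) \<in> symbols a"
    and "(\<lambda>n. mat22 0 0 (rho a (of_nat n - 2)) 0) \<in> symbols a"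
proof -
  define J where "J n = mat22 0 (rho a (of_nat n)) (rho a (of_nat n - 2)) 0" for n
  define N where "N n = mat22 (of_nat n) 0 0 (of_nat n - 2 :: complex)" for n
  have J: "J \<in> symbols a" and N: "N \<in> symbols a"
    using symbols_D2[OF assms] symbols_number by (simp_all add: J_def[abs_def] N_def[abs_def])
  have "(\<lambda>n. mat22 0 (of_nat n * rho a (of_nat n)) ((of_nat n - 2) * rho a (of_nat n - 2)) 0) \<in> symbols a"
    using symbols_mult[OF N J] by (simp add: J_def N_def mat22_mult)
  moreover have "(\<lambda>n. mat22 0 ((of_nat n - 2) * rho a (of_nat n)) (of_nat n * rho a (of_nat n - 2)) 0) \<in> symbols a"
    using symbols_mult[OF J N] by (simp add: J_def N_def mat22_mult mult.commute)
  then have "(\<lambda>n. mat22 0 (- ((of_nat n - 2) * rho a (of_nat n))) (- (of_nat n * rho a (of_nat n - 2))) 0) \<in> symbols a"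
    by (auto dest: symbols_scale[where k = "-1"])
  ultimately have K: "(\<lambda>n. mat22 0 (2 * rho a (of_nat n)) (- 2 * rho a (of_nat n - 2)) 0) \<in> symbols a"
    by (auto dest: symbols_add simp: mat22_add algebra_simps)
  from symbols_add[OF symbols_scale[OF K, of "1/4"] symbols_scale[OF symbols_D2[OF assms], of "1/2"]]
  show "(\<lambda>n. mat22 0 (rho a (of_nat n)) 0 0) \<in> symbols a"
    by (simp add: mat22_add)
  from symbols_add[OF symbols_scale[OF K, of "-1/4"] symbols_scale[OF symbols_D2[OF assms], of "1/2"]]
  show "(\<lambda>n. mat22 0 0 (rho a (of_nat n - 2)) 0) \<in> symbols a"
    by (simp add: mat22_add)
qed

text \<open>With r = rho - 1, the polynomial s + r e in the number operator gives the first diagonal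
  entry. In the second it exceeds the target by rho(n-2) e(n-2), which a multiple of the
  \<open>D3\<close> symbol removes. Multiples of the off-diagonal symbols supply b and c.\<close>

lemma eigen_family_symbols:
  assumes "a \<noteq> 0"
  shows "eigen_family a s e b c \<in> symbols a"
proof -
  let ?z = "\<lambda>n. of_nat n :: complex"
  define r where "r = [:of_real (a\<^sup>2) / 2, 3 * of_real (a\<^sup>2) / 4, of_real (a\<^sup>2) / 4 :: complex:]"
  have r: "poly r z = rho a z - 1" for z
    by (simp add: r_def rho_def field_simps)
  have "(\<lambda>n. mat22 (poly (s + r * e) (?z n)) 0 0 (poly (s + r * e) (?z n - 2))) \<in> symbols a"
    by (rule symbols_poly)
  moreover have "(\<lambda>n. mat22 0 0 0 (poly (- e) (?z n - 2) * rho a (?z n - 2))) \<in> symbols a"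
    using symbols_mult[OF symbols_poly[of "- e"] symbols_D3[OF assms]] by (simp add: mat22_mult)
  moreover have "(\<lambda>n. mat22 0 (poly b (?z n) * rho a (?z n)) 0 0) \<in> symbols a"
    using symbols_mult[OF symbols_poly[of b] symbols_off_diagonal(1)[OF assms]] by (simp add: mat22_mult)
  moreover have "(\<lambda>n. mat22 0 0 (rho a (?z n - 2) * poly c (?z n)) 0) \<in> symbols a"
    using symbols_mult[OF symbols_off_diagonal(2)[OF assms] symbols_poly[of c]] by (simp add: mat22_mult)
  ultimately have "(\<lambda>n. mat22 (poly (s + r * e) (?z n)) 0 0 (poly (s + r * e) (?z n - 2)) +
      (mat22 0 0 0 (poly (- e) (?z n - 2) * rho a (?z n - 2)) +
      (mat22 0 (poly b (?z n) * rho a (?z n)) 0 0 +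
       mat22 0 0 (rho a (?z n - 2) * poly c (?z n)) 0))) \<in> symbols a"
    by (intro symbols_add)
  also have "(\<lambda>n. mat22 (poly (s + r * e) (?z n)) 0 0 (poly (s + r * e) (?z n - 2)) +
      (mat22 0 0 0 (poly (- e) (?z n - 2) * rho a (?z n - 2)) +
      (mat22 0 (poly b (?z n) * rho a (?z n)) 0 0 +
       mat22 0 0 (rho a (?z n - 2) * poly c (?z n)) 0))) = eigen_family a s e b c"
    by (rule ext) (simp add: eigen_family_def Let_def mat22_add mat22_eq_iff r algebra_simps)
  finally show ?thesis .
qed

section \<open>The monic orthogonal polynomials\<close>

lemma pmat_coeff_mat22: "pmat_coeff (mat22 p q r s) k = mat22 (coeff p k) (coeff q k) (coeff r k) (coeff s k)"
  by (simp add: pmat_coeff_def vec_eq_iff forall_2)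

lemma pmat_coeff_diff: "pmat_coeff (A - B) k = pmat_coeff A k - pmat_coeff B k"
  by (simp add: pmat_coeff_def vec_eq_iff)

lemma pmat_coeff_zero: "pmat_coeff 0 k = 0"
  by (simp add: pmat_coeff_def vec_eq_iff)

lemma pmat_coeff_const_mult: "pmat_coeff (pmat_const C ** P) k = C ** pmat_coeff P k"
  by (simp add: pmat_coeff_def pmat_const_def matrix_matrix_mult_def vec_eq_iff coeff_sum)

lemma pmat_eqI_coeff: "(\<And>k. pmat_coeff A k = pmat_coeff B k) \<Longrightarrow> A = B"
  by (simp add: pmat_coeff_def vec_eq_iff poly_eq_iff)

text \<open>The coefficient of x^n in \<open>Q a n\<close>; its determinant is rho(n - 2).\<close>

definition Q_lead :: "real \<Rightarrow> nat \<Rightarrow> complex ^ 2 ^ 2" where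
  "Q_lead a n = mat22 1 (- of_real a * (2 * of_nat n + 1) / 2) 0 (rho a (of_nat n - 2))"

definition Q_lead_inv :: "real \<Rightarrow> nat \<Rightarrow> complex ^ 2 ^ 2" where
  "Q_lead_inv a n = mat22 1 (of_real a * (2 * of_nat n + 1) / (2 * rho a (of_nat n - 2))) 0
     (1 / rho a (of_nat n - 2))"

text \<open>At n = 0 and n = 1 the argument is a root of (z + 1)(z + 2), so the value is 1; from n =
  2 on positivity applies.\<close>

lemma rho_nonzero': "rho a (of_nat n - 2) \<noteq> 0"
proof (cases "n < 2")
  case True
  then show ?thesis by (auto simp: rho_def less_2_cases_iff)
next
  case False
  then have "of_nat n - 2 = (of_nat (n - 2) :: complex)" by (simp add: of_nat_diff)
  then show ?thesis by (simp only: rho_nonzero not_False_eq_True)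
qed

lemma Q_lead_inv_mult: "Q_lead_inv a n ** Q_lead a n = mat 1" "Q_lead a n ** Q_lead_inv a n = mat 1"
  using rho_nonzero'[of a n]
  by (simp_all add: Q_lead_def Q_lead_inv_def mat22_mult mat22_mat mat22_eq_iff divide_simps)

lemma coeff_power2_pX_mult: "coeff (pX ^ 2 * p) (k :: nat) = (if k < 2 then 0 else coeff p (k - 2))"
  by (simp add: power2_eq_square coeff_pCons split: nat.split)

lemma pmat_coeff_Q: "pmat_coeff (Q a n) n = Q_lead a n"
proof -
  have 1: "coeff (pderiv (hermite n)) (n - 1) = of_nat n"
    by (cases n) (simp_all add: pderiv_hermite coeff_hermite_self del: hermite.simps(2))
  have 2: "coeff (pX * pderiv (hermite n)) n = of_nat n"
    using 1 by (cases n) (simp_all add: coeff_pderiv)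
  have 3: "coeff (pderiv (pderiv (hermite n))) n = 0"
    by (simp add: coeff_pderiv coeff_hermite_above)
  have 4: "coeff (pX ^ 2 * pderiv (pderiv (hermite n))) n = of_nat n * (of_nat n - 1)"
  proof (cases "n < 2")
    case True
    then show ?thesis by (auto simp: coeff_power2_pX_mult less_2_cases_iff)
  next
    case False
    then obtain m where "n = Suc (Suc m)" by (metis less_2_cases_iff not0_implies_Suc One_nat_def)
    then show ?thesis
      by (simp add: coeff_power2_pX_mult pderiv_hermite pderiv_smult coeff_hermite_self
          del: hermite.simps)
  qed
  show ?thesis
    unfolding Q_def Q_lead_def pmat_coeff_mat22 mat22_eq_iff
    by (simp only: coeff_smult coeff_add 2 3 4 coeff_hermite_self)
       (simp add: rho_def field_simps)
qed

lemma pmat_coeff_Q_above: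
  assumes "n < k"
  shows "pmat_coeff (Q a n) k = 0"
proof -
  have "coeff (pX * pderiv (hermite n)) k = 0"
    using assms by (cases k) (simp_all add: coeff_pderiv coeff_hermite_above)
  moreover have "coeff (pderiv (pderiv (hermite n))) k = 0"
    using assms by (simp add: coeff_pderiv coeff_hermite_above)
  moreover have "coeff (pX ^ 2 * pderiv (pderiv (hermite n))) k = 0"
    using assms by (auto simp: coeff_power2_pX_mult coeff_pderiv intro!: coeff_hermite_above)
  ultimately show ?thesis
    unfolding Q_def pmat_coeff_mat22
    using assms by (simp add: coeff_hermite_above mat22_zero mat22_eq_iff del: mult_pCons_left)
qed

lemma pmat_reduce:
  assumes "\<And>k. n < k \<Longrightarrow> pmat_coeff Z k = 0"
  obtains C where "\<And>k. n \<le> k \<Longrightarrow> pmat_coeff (Z - pmat_const C ** Q a n) k = 0"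
proof (rule that[of "pmat_coeff Z n ** Q_lead_inv a n"])
  fix k assume "n \<le> k"
  show "pmat_coeff (Z - pmat_const (pmat_coeff Z n ** Q_lead_inv a n) ** Q a n) k = 0"
  proof (cases "k = n")
    case True
    then show ?thesis
      by (simp add: pmat_coeff_diff pmat_coeff_const_mult pmat_coeff_Q matrix_mul_assoc[symmetric]
          Q_lead_inv_mult)
  next
    case False
    with \<open>n \<le> k\<close> have "n < k" by simp
    then show ?thesis
      by (simp add: pmat_coeff_diff pmat_coeff_const_mult pmat_coeff_Q_above assms)
  qed
qed

text \<open>Invertible leading coefficients make the \<open>Q a n\<close> a basis with constant
  matrices as left coefficients, so the top degree can be removed step by step.\<close>

lemma pmat_Q_induct:
  assumes add: "\<And>A B. S A \<Longrightarrow> S B \<Longrightarrow> S (A + B)"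
    and const: "\<And>C n. S (pmat_const C ** Q a n)"
  shows "S Z"
proof -
  have main: "S Z" if "\<And>k. n \<le> k \<Longrightarrow> pmat_coeff Z k = 0" for n Z
    using that
  proof (induction n arbitrary: Z)
    case 0
    then have "Z = pmat_const 0 ** Q a 0"
      by (intro pmat_eqI_coeff) (simp add: pmat_coeff_const_mult)
    then show ?case by (simp only: const)
  next
    case (Suc n)
    then obtain C where "\<And>k. n \<le> k \<Longrightarrow> pmat_coeff (Z - pmat_const C ** Q a n) k = 0"
      using pmat_reduce[of n Z a] by (metis Suc_le_eq)
    from add[OF Suc.IH[OF this] const[of C n]] show ?case by simp
  qed
  show ?thesis
  proof (rule main)
    fix k
    assume k: "Suc (\<Sum>i\<in>UNIV. \<Sum>j\<in>UNIV. degree (Z $ i $ j)) \<le> k"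
    show "pmat_coeff Z k = 0"
      using k by (auto simp: pmat_coeff_def vec_eq_iff forall_2 sum_2 intro!: coeff_eq_0)
  qed
qed

section \<open>The inner product through the factorisation of the weight\<close>

definition pmat_adj :: "'n::finite pmat \<Rightarrow> 'n pmat" where
  "pmat_adj A = (\<chi> i j. map_poly cnj (A $ j $ i))"

lemma map_poly_cnj_add: "map_poly cnj (p + q) = map_poly cnj p + map_poly cnj q"
  by (rule poly_eqI) (simp add: coeff_map_poly)

lemma map_poly_cnj_smult: "map_poly cnj (smult c p) = smult (cnj c) (map_poly cnj p)"
  by (rule poly_eqI) (simp add: coeff_map_poly)

lemma map_poly_cnj_minus: "map_poly cnj (- p) = - map_poly cnj p"
  by (rule poly_eqI) (simp add: coeff_map_poly)

lemma map_poly_cnj_mult: "map_poly cnj (p * q) = map_poly cnj p * map_poly cnj q"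
  by (rule poly_eqI) (simp add: coeff_map_poly coeff_mult)

text \<open>On the real line conjugation stays within polynomials, so the integrand of the inner
  product is e^(-x^2) times a polynomial matrix.\<close>

lemma poly_map_poly_cnj: "poly (map_poly cnj p) (of_real x) = cnj (poly p (of_real x))"
  by (induction p) (simp_all add: map_poly_pCons)

lemma pmat_adj_mult: "pmat_adj (A ** B) = pmat_adj B ** pmat_adj A"
proof -
  have "map_poly cnj (sum f I) = (\<Sum>i\<in>I. map_poly cnj (f i))" for f :: "'a \<Rightarrow> complex poly" and I
    by (induction I rule: infinite_finite_induct) (simp_all add: map_poly_cnj_add)
  then show ?thesis
    by (simp add: pmat_adj_def matrix_matrix_mult_def vec_eq_iff map_poly_cnj_mult mult.commute)
qed

lemma pmat_adj_const: "pmat_adj (pmat_const C) = pmat_const (conj_transpose C)"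
  by (simp add: pmat_adj_def pmat_const_def conj_transpose_def vec_eq_iff map_poly_pCons)

definition gauss_mat :: "'n::finite pmat \<Rightarrow> complex ^ 'n ^ 'n" where
  "gauss_mat A = (\<chi> i j. gauss (A $ i $ j))"

lemma gauss_mat_diff: "gauss_mat (A - B) = gauss_mat A - gauss_mat B"
  by (simp add: gauss_mat_def vec_eq_iff gauss_diff)

lemma gauss_mat_const_mult: "gauss_mat (pmat_const C ** A) = C ** gauss_mat A"
  by (simp add: gauss_mat_def pmat_const_def matrix_matrix_mult_def vec_eq_iff gauss_sum gauss_smult)

lemma gauss_mat_mult_const: "gauss_mat (A ** pmat_const C) = gauss_mat A ** C"
  by (simp add: gauss_mat_def pmat_const_def matrix_matrix_mult_def vec_eq_iff gauss_sum gauss_smult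
      mult.commute)

text \<open>The matrix is the sum of its entries under the bounded linear embeddings
  \<open>E i j\<close>, which commute with the integral.\<close>

lemma has_bochner_integral_gauss_mat:
  fixes A :: "'n::finite pmat"
  shows "has_bochner_integral lborel (\<lambda>x. exp (- x\<^sup>2) *\<^sub>R pmat_eval A x) (gauss_mat A)"
proof -
  define E :: "'n \<Rightarrow> 'n \<Rightarrow> complex \<Rightarrow> complex ^ 'n ^ 'n" where "E i j z = axis i (axis j z)" for i j z
  have E: "bounded_linear (E i j)" for i j
    unfolding linear_conv_bounded_linear[symmetric]
    by (rule linearI) (simp_all add: E_def axis_def vec_eq_iff)
  have sum_E: "(\<Sum>i\<in>UNIV. \<Sum>j\<in>UNIV. E i j (f i j)) = (\<chi> i j. f i j)" for f
  proof -
    have "(\<Sum>i\<in>UNIV. \<Sum>j\<in>UNIV. E i j (f i j)) $ k $ l = f k l" for k l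
    proof -
      have "(\<Sum>j\<in>UNIV. E i j (f i j) $ k $ l) = (if i = k then f i l else 0)" for i
        by (cases "i = k") (simp_all add: E_def axis_def)
      then show ?thesis by (simp add: sum_component)
    qed
    then show ?thesis by (simp add: vec_eq_iff)
  qed
  have "has_bochner_integral lborel
      (\<lambda>x. \<Sum>i\<in>UNIV. \<Sum>j\<in>UNIV. E i j (exp (- x\<^sup>2) *\<^sub>R poly (A $ i $ j) (of_real x)))
      (\<Sum>i\<in>UNIV. \<Sum>j\<in>UNIV. E i j (gauss (A $ i $ j)))"
    by (intro has_bochner_integral_sum has_bochner_integral_bounded_linear[OF E]
        has_bochner_integral_gauss)
  moreover have "(\<chi> i j. exp (- x\<^sup>2) *\<^sub>R poly (A $ i $ j) (of_real x)) =
      exp (- x\<^sup>2) *\<^sub>R pmat_eval A x" for x :: real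
    by (simp add: pmat_eval_def vec_eq_iff)
  ultimately show ?thesis
    by (simp add: sum_E gauss_mat_def)
qed

definition ip :: "real \<Rightarrow> 2 pmat \<Rightarrow> 2 pmat \<Rightarrow> complex ^ 2 ^ 2" where
  "ip a P R = gauss_mat (P ** Tmat a ** pmat_adj (R ** Tmat a))"

text \<open>Since the weight is e^(-x^2) times T and its adjoint, P W R^* equals e^(-x^2) times P T
  and the adjoint of R T.\<close>

lemma weight_inner_eq_ip: "weight_inner (- \<infinity>) \<infinity> (W_ex a) P R = ip a P R"
proof -
  have "pmat_eval P x ** W_ex a x ** conj_transpose (pmat_eval R x) =
      exp (- x\<^sup>2) *\<^sub>R pmat_eval (P ** Tmat a ** pmat_adj (R ** Tmat a)) x" for x
    unfolding pmat_adj_mult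
    by (simp add: vec_eq_iff forall_2 matrix_matrix_mult_def sum_2 pmat_eval_def W_ex_def Tmat_def
        conj_transpose_def pmat_adj_def poly_map_poly_cnj map_poly_pCons)
       (simp add: scaleR_conv_of_real algebra_simps power2_eq_square power4_eq_xxxx)
  then show ?thesis
    unfolding weight_inner_def ip_def interval_lebesgue_integral_def set_lebesgue_integral_def
    using has_bochner_integral_gauss_mat[of "P ** Tmat a ** pmat_adj (R ** Tmat a)"]
    by (simp add: has_bochner_integral_iff)
qed

lemma ip_const_left: "ip a (pmat_const C ** P) R = C ** ip a P R"
  by (simp add: ip_def gauss_mat_const_mult flip: matrix_mul_assoc)

lemma ip_const_right: "ip a P (pmat_const C ** R) = ip a P R ** conj_transpose C"
  by (simp add: ip_def pmat_adj_mult pmat_adj_const gauss_mat_mult_const flip: matrix_mul_assoc)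
     (simp add: matrix_mul_assoc gauss_mat_mult_const)

lemma pmat_diff_mult: "(A - B) ** C = A ** C - B ** (C :: 'n::finite pmat)"
  by (simp add: matrix_matrix_mult_def vec_eq_iff left_diff_distrib sum_subtractf)

lemma ip_diff_left: "ip a (P - P') R = ip a P R - ip a P' R"
  by (simp add: ip_def pmat_diff_mult gauss_mat_diff)

text \<open>Everything reduces to Hermite orthogonality of the entries of \<open>U\<close>. The two
  rows are orthogonal because a hnorm(k + 2) = v(k + 2) hnorm(k), which explains the coefficient -a
  n (n - 1) / 4 in \<open>U\<close>.\<close>

lemma ip_Q_Q:
  "ip a (Q a n) (Q a m) = (if n = m then mat22 (of_real (hnorm n + a\<^sup>2 * hnorm (n + 2))) 0 0
     (of_real (hnorm n + (a * real (n * (n - 1)) / 4)\<^sup>2 * hnorm (n - 2))) else 0)"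
proof -
  define v where "v n = a * real (n * (n - 1)) / 4" for n
  have U: "U a n = mat22 (hermite n) (smult (of_real a) (hermite (n + 2)))
      (smult (- of_real (v n)) (hermite (n - 2))) (hermite n)" for n
    by (simp add: U_def pderiv_pderiv_hermite v_def mat22_eq_iff del: hermite.simps)
  have adj: "pmat_adj (mat22 p q r s) = mat22 (map_poly cnj p) (map_poly cnj r) (map_poly cnj q) (map_poly cnj s)"
    for p q r s
    by (simp add: pmat_adj_def vec_eq_iff forall_2)
  have gm: "gauss_mat (mat22 p q r s) = mat22 (gauss p) (gauss q) (gauss r) (gauss s)" for p q r s
    by (simp add: gauss_mat_def vec_eq_iff forall_2)
  have v_small: "v n = 0" if "n < 2" for n
    using that by (auto simp: v_def less_2_cases_iff)
  have norm2: "a * hnorm (k + 2) = v (k + 2) * hnorm k" for k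
    by (simp add: hnorm_def v_def field_simps)
  have off: "a * gauss (hermite (n + 2) * hermite m) = v m * gauss (hermite n * hermite (m - 2))" for n m
  proof (cases "m < 2")
    case True
    then show ?thesis by (simp add: v_small gauss_hermite_hermite del: hermite.simps)
  next
    case False
    then obtain k where "m = k + 2" by (metis le_add_diff_inverse2 not_less)
    then show ?thesis
      using norm2[of k, THEN arg_cong[of _ _ complex_of_real]]
      by (simp add: gauss_hermite_hermite del: hermite.simps add_2_eq_Suc')
  qed
  have diag: "v n * v m * gauss (hermite (n - 2) * hermite (m - 2)) =
      (if n = m then (v n)\<^sup>2 * hnorm (n - 2) else 0)"
    by (cases "n < 2"; cases "m < 2")
       (auto simp: v_small gauss_hermite_hermite power2_eq_square simp del: hermite.simps)
  have "ip a (Q a n) (Q a m) = mat22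
      (gauss (hermite n * hermite m) + of_real (a\<^sup>2) * gauss (hermite (n + 2) * hermite (m + 2)))
      (a * gauss (hermite (n + 2) * hermite m) - v m * gauss (hermite n * hermite (m - 2)))
      (a * gauss (hermite (m + 2) * hermite n) - v n * gauss (hermite m * hermite (n - 2)))
      (gauss (hermite n * hermite m) + v n * v m * gauss (hermite (n - 2) * hermite (m - 2)))"
    unfolding ip_def Q_Tmat U adj mat22_mult gm mat22_eq_iff
    by (simp add: map_poly_cnj_smult map_poly_cnj_minus cnj_hermite gauss_add gauss_diff gauss_smult gauss_minus power2_eq_square mult_ac
        del: hermite.simps)
  then show ?thesis
    unfolding off diag
    by (simp add: gauss_hermite_hermite mat22_eq_iff mat22_zero v_def del: hermite.simps)
qed

lemma eq_zero_if_mult_ip_zero: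
  fixes C :: "complex ^ 2 ^ 2"
  assumes "C ** ip a (Q a n) (Q a n) = 0"
  shows "C = 0"
proof -
  define p where "p = hnorm n + a\<^sup>2 * hnorm (n + 2)"
  define q where "q = hnorm n + (a * real (n * (n - 1)) / 4)\<^sup>2 * hnorm (n - 2)"
  have "p > 0" "q > 0"
    unfolding p_def q_def
    by (intro add_pos_nonneg mult_nonneg_nonneg zero_le_power2 hnorm_pos hnorm_pos[THEN less_imp_le])+
  moreover have "C ** mat22 (of_real p) 0 0 (of_real q) = 0"
    using assms by (simp add: ip_Q_Q p_def q_def)
  moreover obtain w x y z where "C = mat22 w x y z"
    using mat22_eta by blast
  ultimately show ?thesis
    by (simp add: mat22_mult mat22_zero mat22_eq_iff)
qed

text \<open>Subtracting a left multiple of the top \<open>Q\<close> leaves, by induction, zero.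
  Pairing with that \<open>Q\<close>, whose norm matrix is positive diagonal, shows that the
  multiple is zero too.\<close>

lemma eq_zero_if_orthogonal:
  assumes "\<And>k. n \<le> k \<Longrightarrow> pmat_coeff Z k = 0" and "\<And>m. m < n \<Longrightarrow> ip a Z (Q a m) = 0"
  shows "Z = 0"
  using assms
proof (induction n arbitrary: Z)
  case 0
  then show ?case by (intro pmat_eqI_coeff) (simp add: pmat_coeff_def vec_eq_iff)
next
  case (Suc n)
  obtain C where C: "\<And>k. n \<le> k \<Longrightarrow> pmat_coeff (Z - pmat_const C ** Q a n) k = 0"
    using pmat_reduce[of n Z a] Suc.prems(1) by (metis Suc_le_eq)
  have "Z - pmat_const C ** Q a n = 0"
    by (rule Suc.IH[OF C]) (simp_all add: ip_diff_left ip_const_left ip_Q_Q Suc.prems)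
  then have Z: "Z = pmat_const C ** Q a n" by simp
  have "C ** ip a (Q a n) (Q a n) = 0"
    using Suc.prems(2)[of n] by (simp add: Z ip_const_left)
  then have "C = 0" by (rule eq_zero_if_mult_ip_zero)
  then show ?case
    by (intro pmat_eqI_coeff) (simp add: Z pmat_coeff_const_mult pmat_coeff_zero)
qed

lemma Q_eq_lead: "Q a n = pmat_const (Q_lead a n) ** (pmat_const (Q_lead_inv a n) ** Q a n)"
  by (simp add: matrix_mul_assoc Q_lead_inv_mult pmat_const_one flip: pmat_const_mult)

lemma is_monic_ops_Q: "is_monic_ops (- \<infinity>) \<infinity> (W_ex a) (\<lambda>n. pmat_const (Q_lead_inv a n) ** Q a n)"
  unfolding is_monic_ops_def monic_of_degree_def weight_inner_eq_ip
  by (simp add: pmat_coeff_const_mult pmat_coeff_Q pmat_coeff_Q_above Q_lead_inv_mult ip_const_left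
      ip_const_right ip_Q_Q)

text \<open>The difference of two monic candidates has degree below n. By induction each earlier
  \<open>Q a m\<close> is a constant multiple of \<open>P m\<close>, so the difference is orthogonal
  to all of them.\<close>

lemma is_monic_ops_unique:
  assumes "is_monic_ops (- \<infinity>) \<infinity> (W_ex a) P"
  shows "P n = pmat_const (Q_lead_inv a n) ** Q a n"
proof (induction n rule: less_induct)
  case (less n)
  let ?R = "\<lambda>n. pmat_const (Q_lead_inv a n) ** Q a n"
  have monic: "monic_of_degree n (P n)" "monic_of_degree n (?R n)"
    using assms is_monic_ops_Q[of a] unfolding is_monic_ops_def by blast+
  have "P n - ?R n = 0"
  proof (rule eq_zero_if_orthogonal)
    fix k assume "n \<le> k"
    then show "pmat_coeff (P n - ?R n) k = 0"
      using monic unfolding monic_of_degree_def pmat_coeff_diff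
      by (cases "k = n") auto
  next
    fix m assume "m < n"
    then have "ip a (P n) (P m) = 0" "ip a (?R n) (Q a m) = 0"
      using assms unfolding is_monic_ops_def weight_inner_eq_ip
      by (auto simp: ip_const_left ip_Q_Q)
    moreover have "Q a m = pmat_const (Q_lead a m) ** P m"
      unfolding less.IH[OF \<open>m < n\<close>] by (rule Q_eq_lead)
    ultimately show "ip a (P n - ?R n) (Q a m) = 0"
      by (metis ip_diff_left ip_const_right diff_self times0_left)
  qed
  then show ?case by simp
qed

section \<open>From the monic polynomials back to \<open>Q\<close>, and the conclusion\<close>

lemma monic_ops_eq: "monic_ops (- \<infinity>) \<infinity> (W_ex a) n = pmat_const (Q_lead_inv a n) ** Q a n"
proof -
  have "monic_ops (- \<infinity>) \<infinity> (W_ex a) = (\<lambda>n. pmat_const (Q_lead_inv a n) ** Q a n)"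
    unfolding monic_ops_def
    by (rule the_equality, rule is_monic_ops_Q) (simp add: fun_eq_iff is_monic_ops_unique)
  then show ?thesis by simp
qed

text \<open>\<open>P n\<close> and \<open>Q a n\<close> differ by an invertible constant left
  factor, which only conjugates the eigenvalue.\<close>

lemma DW_iff: "D \<in> DW (- \<infinity>) \<infinity> (W_ex a) \<longleftrightarrow> (\<exists>L. \<forall>n. dop_act (Q a n) D = pmat_const (L n) ** Q a n)"
proof -
  let ?P = "\<lambda>n. pmat_const (Q_lead_inv a n) ** Q a n"
  have "(\<exists>M. dop_act (?P n) D = pmat_const M ** ?P n) \<longleftrightarrow>
      (\<exists>M. dop_act (Q a n) D = pmat_const M ** Q a n)" for n
  proof
    assume "\<exists>M. dop_act (?P n) D = pmat_const M ** ?P n"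
    then obtain M where "dop_act (?P n) D = pmat_const M ** ?P n" ..
    then have "dop_act (Q a n) D = pmat_const (Q_lead a n) ** (pmat_const M ** ?P n)"
      by (subst Q_eq_lead) (simp add: dop_act_const_mult)
    then show "\<exists>M. dop_act (Q a n) D = pmat_const M ** Q a n"
      by (intro exI[of _ "Q_lead a n ** M ** Q_lead_inv a n"]) (simp add: pmat_const_mult matrix_mul_assoc)
  next
    assume "\<exists>M. dop_act (Q a n) D = pmat_const M ** Q a n"
    then obtain M where "dop_act (Q a n) D = pmat_const M ** Q a n" ..
    then have "dop_act (?P n) D = pmat_const (Q_lead_inv a n) ** (pmat_const M ** (pmat_const (Q_lead a n) ** ?P n))"
      by (simp add: dop_act_const_mult flip: Q_eq_lead)
    then show "\<exists>M. dop_act (?P n) D = pmat_const M ** ?P n"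
      by (intro exI[of _ "Q_lead_inv a n ** M ** Q_lead a n"]) (simp add: pmat_const_mult matrix_mul_assoc)
  qed
  then show ?thesis
    unfolding DW_def monic_ops_eq mem_Collect_eq by (simp add: choice_iff)
qed

text \<open>The \<open>Q a n\<close> span all matrix polynomials over left constants, and an
  operator is determined by its action on these.\<close>

lemma diffop_eqI:
  assumes "\<And>n. dop_act (Q a n) D = dop_act (Q a n) E"
  shows "D = E"
proof (rule dop_act_inject)
  fix Z
  show "dop_act Z D = dop_act Z E"
    by (induction Z rule: pmat_Q_induct[where a = a])
       (simp_all add: dop_act_left_add dop_act_const_mult assms)
qed

lemma dop_algebra_eigen:
  assumes "a \<noteq> 0" "D \<in> dop_algebra {dop_one, D1 a, D2 a, D3 a}"
  shows "\<exists>L. \<forall>n. dop_act (Q a n) D = pmat_const (L n) ** Q a n"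
  using assms(2)
proof induction
  case (gen D)
  have "dop_act (Q a n) dop_one = pmat_const (mat 1) ** Q a n" for n
    by (simp add: dop_act_one pmat_const_one)
  then have "\<exists>L. \<forall>n. dop_act (Q a n) dop_one = pmat_const (L n) ** Q a n"
    by (intro exI[of _ "\<lambda>_. mat 1"] allI)
  moreover have "\<exists>L. \<forall>n. dop_act (Q a n) (D1 a) = pmat_const (L n) ** Q a n"
    using dop_act_Q_D1 by (intro choice) blast
  moreover have "\<exists>L. \<forall>n. dop_act (Q a n) (D2 a) = pmat_const (L n) ** Q a n"
    using dop_act_Q_D2[OF assms(1)] by (intro choice) blast
  moreover have "\<exists>L. \<forall>n. dop_act (Q a n) (D3 a) = pmat_const (L n) ** Q a n"
    using dop_act_Q_D3[OF assms(1)] by (intro choice) blast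
  ultimately show ?case using gen by auto
next
  case zero
  have "pmat_const (0 :: complex ^ 2 ^ 2) = 0"
    by (simp add: pmat_const_def vec_eq_iff)
  then have "\<forall>n. dop_act (Q a n) 0 = pmat_const 0 ** Q a n"
    by (simp add: dop_act_zero pmat_mult_zero)
  then show ?case by (intro exI[of _ "\<lambda>_. 0"])
next
  case (add D E)
  then obtain L M where "\<forall>n. dop_act (Q a n) D = pmat_const (L n) ** Q a n"
    "\<forall>n. dop_act (Q a n) E = pmat_const (M n) ** Q a n" by blast
  then show ?case
    by (intro exI[of _ "\<lambda>n. L n + M n"]) (simp add: dop_act_add pmat_const_add pmat_add_mult)
next
  case (scale D k)
  then obtain L where L: "\<forall>n. dop_act (Q a n) D = pmat_const (L n) ** Q a n" by blast
  have "pmat_scale k (pmat_const (L n)) = pmat_const (\<chi> i j. k * L n $ i $ j)" for n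
    by (simp add: pmat_scale_def pmat_const_def vec_eq_iff)
  then show ?case
    using L by (intro exI[of _ "\<lambda>n. \<chi> i j. k * L n $ i $ j"])
      (simp add: dop_act_scale flip: pmat_scale_mult(2))
next
  case (mult D E)
  then obtain L M where "\<forall>n. dop_act (Q a n) D = pmat_const (L n) ** Q a n"
    "\<forall>n. dop_act (Q a n) E = pmat_const (M n) ** Q a n" by blast
  then show ?case
    by (intro exI[of _ "\<lambda>n. L n ** M n"])
       (simp add: dop_act_mult dop_act_const_mult pmat_const_mult matrix_mul_assoc)
qed

theorem proposition5p7:
  fixes a :: real
  assumes "a \<noteq> 0"
  shows "DW (- \<infinity>) \<infinity> (W_ex a) = dop_algebra {dop_one, D1 a, D2 a, D3 a}"
proof (intro set_eqI iffI)
  fix D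
  assume "D \<in> DW (- \<infinity>) \<infinity> (W_ex a)"
  then obtain L where L: "\<And>n. dop_act (Q a n) D = pmat_const (L n) ** Q a n"
    unfolding DW_iff by blast
  obtain s e b c where "L = eigen_family a s e b c"
    using eigenvalue_form[OF assms L] by blast
  then have "L \<in> symbols a"
    using eigen_family_symbols[OF assms] by simp
  then obtain G where G: "G \<in> dop_algebra {dop_one, D1 a, D2 a, D3 a}"
    "\<And>n. dop_act (Q a n) G = pmat_const (L n) ** Q a n"
    unfolding symbols_def by auto
  \<comment> \<open>Both operators have the eigenvalues L on every \<open>Q a n\<close>.\<close>
  have "D = G"
    by (rule diffop_eqI[of a]) (simp add: L G(2))
  then show "D \<in> dop_algebra {dop_one, D1 a, D2 a, D3 a}"
    using G(1) by simp
next
  fix D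
  assume "D \<in> dop_algebra {dop_one, D1 a, D2 a, D3 a}"
  then show "D \<in> DW (- \<infinity>) \<infinity> (W_ex a)"
    using dop_algebra_eigen[OF assms] DW_iff by blast
qed

end
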